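(* Let $Q_0\in\Delta(L)^K$ be fixed, and suppose that $\zeta\mapsto\mathbf{W}_K^\sharp(\zeta,Q_0)$ is differentiable at $\zeta_0\in\mathbb{R}^K$. Then $$\mathbf{W}(p_0\otimes Q_0)\le u(p_0\otimes Q_0),\quad\text{where } p_0:=-D\mathbf{W}_K^\sharp(\zeta_0,Q_0)\in\Delta(K)$$ (the derivative being with respect to $\zeta$).
   Context: Data. $K,L,I,J$ are finite sets; $\Delta(X)$ is the set of probability distributions on a finite set $X$. $U=\Delta(I)$, $V=\Delta(J)$. For each $(k,\ell)\in K\times L$, $G^{k\ell}:I\times J\to\mathbb{R}$ is a matrix game, extended bilinearly to $U\times V$. Average game. $u(\pi)=\max_{a\in U}\min_{b\in V}\sum_{(k,\ell)}\pi^{k\ell}G^{k\ell}(a,b)=\min_{b\in V}\max_{a\in U}\sum_{(k,\ell)}\pi^{k\ell}G^{k\ell}(a,b)$ for $\pi\in\Delta(K\times L)$. Continuous-time game. A pair $(k,\ell)$ is drawn according to $\pi\in\Delta(K\times L)$; player 1 (maximizer) is informed of $k$, player 2 (minimizer) of $\ell$; they then play on $[0,1]$ with running payoff $G^{k\ell}$ and no state variable. Let $\mathcal{U}$ (resp. $\mathcal{V}$) be the set of Lebesgue-measurable maps $[0,1]\to U$ (resp. $V$), with the $L^1$ topology. Let $\mathcal{S}=\{([0,1]^m,\mathcal{B}([0,1]^m),\mathcal{L}_m): m\ge1\}$ (Borel sets and Lebesgue measure). A random strategy $\alpha\in\mathcal{A}_r$ of player 1 is a pair consisting of a probability space $(\Omega_\alpha,\mathcal{F}_\alpha,\mathbb{P}_\alpha)\in\mathcal{S}$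 and a measurable map $\alpha:\Omega_\alpha\times\mathcal{V}\to\mathcal{U}$ (Borel $\sigma$-fields on $\mathcal{U},\mathcal{V}$) for which there is a finite partition $0=s_0<\dots<s_N=1$ such that for all $0\le m<N$, $\omega\in\Omega_\alpha$, $\mathbf{v}_1,\mathbf{v}_2\in\mathcal{V}$: $\mathbf{v}_1=\mathbf{v}_2$ a.e. on $[s_0,s_m]$ implies $\alpha(\omega,\mathbf{v}_1)=\alpha(\omega,\mathbf{v}_2)$ a.e. on $[s_0,s_{m+1}]$. $\mathcal{B}_r$ is defined symmetrically for player 2. For $(\alpha,\beta)\in\mathcal{A}_r\times\mathcal{B}_r$ and $\omega=(\omega_1,\omega_2)\in\Omega_\alpha\times\Omega_\beta$ there is a unique pair $(\mathbf{u}_\omega,\mathbf{v}_\omega)\in\mathcal{U}\times\mathcal{V}$ (up to a.e. equality) with $\alpha(\omega_1,\mathbf{v}_\omega)=\mathbf{u}_\omega$, $\beta(\omega_2,\mathbf{u}_\omega)=\mathbf{v}_\omega$. For $\hat\alpha=(\hat\alpha^k)_k\in\mathcal{A}_r^K$ and $\hat\beta=(\hat\beta^\ell)_\ell\in\mathcal{B}_r^L$ the payoff is $$\sum_{(k,\ell)}\pi^{k\ell}\int_{\Omega_{\hat\alpha^k}\times\Omega_{\hat\beta^\ell}}\int_0^1G^{k\ell}(\mathbf{u}_\omega(s),\mathbf{v}_\omega(s))\,ds\;d\,\mathbb{P}_{\hat\alpha^k}\otimes\mathbb{P}_{\hat\beta^\ell}(\omega),$$ where $(\mathbf{u}_\omega,\mathbf{v}_\omega)$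 is the pair induced by $(\hat\alpha^k,\hat\beta^\ell)$ at $\omega$. $\mathbf{W}(\pi)$ is the value of this game, i.e. the common value of $\sup_{\hat\alpha}\inf_{\hat\beta}$ and $\inf_{\hat\beta}\sup_{\hat\alpha}$ of this payoff (it exists). Notation. For $p\in\Delta(K)$, $Q\in\Delta(L)^K$: $(p\otimes Q)(k,\ell)=p(k)Q(\ell|k)$, and $\mathbf{W}_K^\sharp(\zeta,Q)=\sup_{p\in\Delta(K)}\{\mathbf{W}(p\otimes Q)-\langle p,\zeta\rangle\}$ for $\zeta\in\mathbb{R}^K$. *)

theory Defs
  imports "HOL-Analysis.Analysis"
begin

text \<open>
  The finite sets \<open>K\<close>, \<open>L\<close>, \<open>I\<close>, \<open>J\<close> are the index types \<open>'k\<close>, \<open>'l\<close>, \<open>'i\<close>, \<open>'j\<close>.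
\<close>

definition prob_simplex :: "(real ^ 'n::finite) set" where
  "prob_simplex = {x. (\<forall>i. 0 \<le> x $ i) \<and> (\<Sum>i\<in>UNIV. x $ i) = 1}"

type_synonym ('k, 'l, 'i, 'j) games = "'k \<Rightarrow> 'l \<Rightarrow> real ^ 'j ^ 'i"

definition bilin :: "real ^ 'j::finite ^ 'i::finite \<Rightarrow> real ^ 'i \<Rightarrow> real ^ 'j \<Rightarrow> real" where
  "bilin M a b = (\<Sum>i\<in>UNIV. \<Sum>j\<in>UNIV. a $ i * M $ i $ j * b $ j)"

text \<open>
  The value of the average game. By compactness and von Neumann's theorem the supremum and
  the infimum are attained and may be exchanged.
\<close>

definition average_value ::
  "('k::finite, 'l::finite, 'i::finite, 'j::finite) games \<Rightarrow> real ^ ('k \<times> 'l) \<Rightarrow> real" where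
  "average_value G \<pi> =
     (SUP a\<in>prob_simplex. INF b\<in>prob_simplex. \<Sum>k\<in>UNIV. \<Sum>l\<in>UNIV. \<pi> $ (k, l) * bilin (G k l) a b)"

text \<open>
  Controls are genuine functions on \<open>[0,1]\<close> (extensional outside), not a.e.-classes, so the
  \<open>L\<^sup>1\<close> distance below is only a pseudo-metric on them. Its open sets are saturated for
  a.e. equality; hence the generated sigma-algebra is the pull-back of the Borel
  sigma-algebra of the quotient.
\<close>

type_synonym 'n control = "real \<Rightarrow> real ^ 'n"

definition controls :: "'n::finite control set" where
  "controls = {f \<in> {0..1} \<rightarrow>\<^sub>E prob_simplex. f \<in> borel_measurable (lebesgue_on {0..1})}"

definition L1_dist :: "'n::finite control \<Rightarrow> 'n control \<Rightarrow> real" where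
  "L1_dist f g = (LINT t|lebesgue_on {0..1}. norm (f t - g t))"

definition control_borel :: "'n::finite control measure" where
  "control_borel = sigma controls
     {A. A \<subseteq> controls \<and> (\<forall>f\<in>A. \<exists>e>0. \<forall>g\<in>controls. L1_dist f g < e \<longrightarrow> g \<in> A)}"

text \<open>
  \<open>[0,1]\<^sup>m\<close> with its Borel sets and Lebesgue measure; the product of the \<open>m\<close> Borel
  sigma-algebras is the Borel sigma-algebra of the cube.
\<close>

definition cube :: "nat \<Rightarrow> (nat \<Rightarrow> real) measure" where
  "cube m = PiM {..<m} (\<lambda>_. restrict_space lborel {0..1})"

text \<open>
  A random strategy is a pair \<open>(m, \<alpha>)\<close>, where \<open>m\<close> gives the probability space \<open>cube m\<close>.
  The first index type is that of the strategy's owner, the second that of the opponent, so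
  that this set is \<open>\<A>\<^sub>r\<close> at type \<open>('i, 'j) strategy\<close> and \<open>\<B>\<^sub>r\<close> at type
  \<open>('j, 'i) strategy\<close>.
\<close>

type_synonym ('m, 'n) strategy = "nat \<times> ((nat \<Rightarrow> real) \<times> 'n control \<Rightarrow> 'm control)"

definition random_strategies :: "('m::finite, 'n::finite) strategy set" where
  "random_strategies = {(m, \<alpha>). 1 \<le> m \<and>
     \<alpha> \<in> measurable (cube m \<Otimes>\<^sub>M control_borel) control_borel \<and>
     (\<exists>(N::nat) (s::nat \<Rightarrow> real). s 0 = 0 \<and> s N = 1 \<and> (\<forall>r<N. s r < s (Suc r)) \<and>
       (\<forall>r<N. \<forall>\<omega>\<in>space (cube m). \<forall>v1\<in>controls. \<forall>v2\<in>controls.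
          (AE t in lebesgue_on {s 0..s r}. v1 t = v2 t) \<longrightarrow>
          (AE t in lebesgue_on {s 0..s (Suc r)}. \<alpha> (\<omega>, v1) t = \<alpha> (\<omega>, v2) t)))}"

text \<open>
  The pair induced by two strategies at \<open>(\<omega>\<^sub>1, \<omega>\<^sub>2)\<close> is unique up to a.e. equality, and
  \<open>payoff\<close> does not depend on the representative chosen here. As controls are functions, the
  fixed-point equations can only be required almost everywhere.
\<close>

definition induced ::
  "('i::finite, 'j::finite) strategy \<Rightarrow> ('j, 'i) strategy \<Rightarrow> (nat \<Rightarrow> real) \<times> (nat \<Rightarrow> real) \<Rightarrow>
     'i control \<times> 'j control" where
  "induced \<alpha> \<beta> \<omega> = (SOME (u, v). u \<in> controls \<and> v \<in> controls \<and>
     (AE t in lebesgue_on {0..1}. snd \<alpha> (fst \<omega>, v) t = u t) \<and>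
     (AE t in lebesgue_on {0..1}. snd \<beta> (snd \<omega>, u) t = v t))"

definition payoff ::
  "('k::finite, 'l::finite, 'i::finite, 'j::finite) games \<Rightarrow> real ^ ('k \<times> 'l) \<Rightarrow>
     ('k \<Rightarrow> ('i, 'j) strategy) \<Rightarrow> ('l \<Rightarrow> ('j, 'i) strategy) \<Rightarrow> real" where
  "payoff G \<pi> \<alpha> \<beta> = (\<Sum>k\<in>UNIV. \<Sum>l\<in>UNIV. \<pi> $ (k, l) *
     (LINT \<omega>|(cube (fst (\<alpha> k)) \<Otimes>\<^sub>M cube (fst (\<beta> l))).
        LINT s|lebesgue_on {0..1}.
          bilin (G k l) (fst (induced (\<alpha> k) (\<beta> l) \<omega>) s) (snd (induced (\<alpha> k) (\<beta> l) \<omega>) s)))"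

text \<open>
  The game has a value, i.e. \<open>sup inf\<close> and \<open>inf sup\<close> of the payoff coincide, so the value is
  written as one of these two expressions. The payoff is bounded by the largest entry of the
  matrices, so supremum and infimum are those of bounded nonempty sets.
\<close>

definition game_value ::
  "('k::finite, 'l::finite, 'i::finite, 'j::finite) games \<Rightarrow> real ^ ('k \<times> 'l) \<Rightarrow> real" where
  "game_value G \<pi> =
     (INF \<beta>\<in>{\<beta>. \<forall>l. \<beta> l \<in> random_strategies}.
        SUP \<alpha>\<in>{\<alpha>. \<forall>k. \<alpha> k \<in> random_strategies}. payoff G \<pi> \<alpha> \<beta>)"

definition tensor :: "real ^ 'k::finite \<Rightarrow> real ^ 'l::finite ^ 'k \<Rightarrow> real ^ ('k \<times> 'l)" where
  "tensor p Q = (\<chi> x. p $ fst x * Q $ fst x $ snd x)"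

definition W_sharp ::
  "('k::finite, 'l::finite, 'i::finite, 'j::finite) games \<Rightarrow> real ^ 'k \<Rightarrow> real ^ 'l ^ 'k \<Rightarrow> real"
  where "W_sharp G \<zeta> Q = (SUP p\<in>prob_simplex. game_value G (tensor p Q) - p \<bullet> \<zeta>)"

definition gradient :: "(real ^ 'n::finite \<Rightarrow> real) \<Rightarrow> real ^ 'n \<Rightarrow> real ^ 'n" where
  "gradient f x = (\<chi> i. frechet_derivative f (at x) (axis i 1))"

end

(*
  The dual value W_sharp is subdynamic: for every action b of player 2 and every 0 < h < 1,
    W_sharp(z) <= (1 - h) sup_a W_sharp((z - h g(a, b)) / (1 - h)),  g_k(a, b) = sum_l Q(l|k) G^{kl}(a, b),
  because player 2 may play b up to time h, observe the average action a of player 1, and continue with a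
  nearly optimal answer in the dual game at the updated parameter; this needs no knowledge of the strategy of
  player 1. Differentiating at z0 as h tends to 0 gives W_sharp(z0) + <p0, z0> <= sup_a <p0, g(a, b)>
  for all b, and the minimax theorem turns the right-hand side into u(p0 (x) Q0), while the left-hand side
  bounds W(p0 (x) Q0) by definition. A strategy that is good in the dual game exists because the vectors
  of payoffs player 2 can guarantee against the types of player 1 form a convex set (mixing with a coin), so
  that a separating hyperplane provides the adversarial prior p.
*)
theory Submission imports Defs "HOL-Probability.Probability" begin

subsection \<open>Separation and the matrix minimax theorem\<close>

text \<open>There is no state variable and the running payoff does not depend on time, so the game
  on [h,1] is the original one run at another speed, with weight 1 - h. The updated parameter z'
  solves z = h g(a, b) + (1 - h) z', which makes a bound z' + w after time h into the bound z + (1 -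
  h) w for the whole game. Random strategies of player 1 are mixtures of deterministic ones, by
  Fubini, so guarantees of player 2 are tested against deterministic opponents only. Such an
  opponent answers the constant \<open>b\<close> in one determined way up to h, whence the observed
  average is the same for all random outcomes of player 2. Two obstacles shape the rest. First, the
  average ranges over a continuum, whereas a strategy needs one cube, one finite partition and
  measurability; the averages are therefore rounded to a finite net, at a cost h e with e arbitrary.
  A cost of that form survives the division by h when h tends to 0. Second, payoffs are integrals of
  an arbitrarily chosen fixed point, so their measurability has to be won from explicit iterates and
  from limits of finite sums.\<close>

lemma separating_prob_vector:
  fixes S :: "(real ^ 'n::finite) set"
  assumes "convex S" and S: "\<And>x. x \<in> S \<Longrightarrow> \<exists>i. v $ i \<le> x $ i"
  shows "\<exists>p\<in>prob_simplex. \<forall>x\<in>S. p \<bullet> v \<le> p \<bullet> x"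
proof (cases "S = {}")
  case True
  have "axis undefined 1 \<in> (prob_simplex :: (real^'n) set)"
    by (auto simp: prob_simplex_def axis_def)
  then show ?thesis using True by blast
next
  case False
  \<comment> \<open>The hypothesis on \<open>S\<close> says that \<open>S\<close> misses this open
    orthant. The orthant is unbounded in every negative coordinate direction, so the normal of a
    separating hyperplane has nonnegative entries and can be normalised to a probability
    vector.\<close>
  define T where "T = {y::real^'n. \<forall>i. y $ i < v $ i}"
  have T1: "v - e *\<^sub>R 1 \<in> T" if "e > 0" for e using that by (simp add: T_def)
  have "convex T"
    unfolding T_def by (intro convexI) (auto intro!: convex_bound_lt)
  moreover have "T \<noteq> {}" using T1[of 1] by auto
  moreover have "T \<inter> S = {}" using S by (force simp: T_def not_le[symmetric])
  ultimately obtain a b where a: "a \<noteq> 0" and aT: "\<forall>x\<in>T. a \<bullet> x \<le> b" and aS: "\<forall>x\<in>S. b \<le> a \<bullet> x"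
    using separating_hyperplane_sets[of T S] assms False by blast
  have a0: "a $ i \<ge> 0" for i
  proof (rule ccontr)
    assume "\<not> ?thesis" then have n: "a $ i < 0" by simp
    \<comment> \<open>Length of a move against coordinate \<open>i\<close> that would lift the value
      of \<open>a\<close> above \<open>b\<close> if \<open>a $ i\<close> were negative.\<close>
    define t where "t = (\<bar>b - a \<bullet> (v - 1)\<bar> + 1) / (- a $ i)"
    have t: "t > 0" unfolding t_def using n by (intro divide_pos_pos) auto
    have "v - 1 - t *\<^sub>R axis i 1 \<in> T" using t by (auto simp: T_def axis_def)
    then have "a \<bullet> (v - 1 - t *\<^sub>R axis i 1) \<le> b" using aT by blast
    then have "a \<bullet> (v - 1) - t * a $ i \<le> b" by (simp add: inner_diff_right inner_axis)
    moreover have "- t * a $ i = \<bar>b - a \<bullet> (v - 1)\<bar> + 1" using n by (simp add: t_def)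
    ultimately show False by linarith
  qed
  define s where "s = (\<Sum>i\<in>UNIV. a $ i)"
  have s: "s > 0"
  proof -
    obtain i where "a $ i \<noteq> 0" using a by (metis vec_eq_iff zero_index)
    then show ?thesis unfolding s_def using a0 by (intro sum_pos2[of _ i]) (auto simp: less_le)
  qed
  have as: "a \<bullet> (1::real^'n) = s" by (simp add: s_def inner_vec_def)
  have "a \<bullet> v \<le> b"
  \<comment> \<open>\<open>v\<close> lies only on the boundary of \<open>T\<close>; lowering every
    coordinate by \<open>e / s\<close> enters \<open>T\<close> and changes the value of
    \<open>a\<close> by exactly \<open>e\<close>.\<close>
  proof (rule field_le_epsilon)
    fix e :: real assume "e > 0"
    then have "a \<bullet> (v - (e / s) *\<^sub>R 1) \<le> b" using aT T1[of "e/s"] s by auto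
    then show "a \<bullet> v \<le> b + e" using s by (simp add: inner_diff_right as)
  qed
  then have av: "a \<bullet> v \<le> a \<bullet> x" if "x \<in> S" for x using aS that by force
  have "(1/s) *\<^sub>R a \<in> prob_simplex"
    using s a0 by (auto simp: prob_simplex_def sum_distrib_left[symmetric] s_def simp flip: sum_divide_distrib)
  moreover have "\<forall>x\<in>S. ((1/s) *\<^sub>R a) \<bullet> v \<le> ((1/s) *\<^sub>R a) \<bullet> x"
    using av s by (auto intro!: divide_right_mono)
  ultimately show ?thesis by blast
qed

lemma prob_simplexD: "x \<in> prob_simplex \<Longrightarrow> 0 \<le> x $ i" "x \<in> prob_simplex \<Longrightarrow> (\<Sum>i\<in>UNIV. x $ i) = 1"
  by (auto simp: prob_simplex_def)

lemma prob_simplex_le1: "x \<in> prob_simplex \<Longrightarrow> x $ i \<le> 1"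
  using member_le_sum[of i UNIV "($) x"] by (auto simp: prob_simplex_def)

lemma axis_in_prob_simplex: "axis i 1 \<in> prob_simplex"
  by (auto simp: prob_simplex_def axis_def)

lemma prob_simplex_nonempty: "prob_simplex \<noteq> {}"
  using axis_in_prob_simplex by blast

lemma convex_prob_simplex: "convex prob_simplex"
  by (auto simp: prob_simplex_def convex_def sum.distrib simp flip: sum_distrib_left)

lemma inner_le_in_prob_simplex:
  assumes "p \<in> prob_simplex" "\<And>i. x $ i \<le> c"
  shows "p \<bullet> x \<le> c"
proof -
  have "p \<bullet> x \<le> (\<Sum>i\<in>UNIV. p $ i * c)"
    unfolding inner_vec_def using assms by (auto intro!: sum_mono mult_left_mono dest: prob_simplexD)
  then show ?thesis using assms by (simp add: prob_simplexD flip: sum_distrib_right)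
qed

text \<open>Serves both as a bound for \<open>bilin\<close> on the simplices and, in
  \<open>bilin_diff_bound\<close>, as its Lipschitz constant in the first action for the largest
  coordinate difference.\<close>

definition entry_bound :: "real ^ 'j::finite ^ 'i::finite \<Rightarrow> real" where
  "entry_bound M = (\<Sum>i\<in>UNIV. \<Sum>j\<in>UNIV. \<bar>M $ i $ j\<bar>)"

lemma entry_bound_nonneg: "0 \<le> entry_bound M"
  by (auto simp: entry_bound_def intro!: sum_nonneg)

lemma bilin_conv_inner: "bilin M a b = a \<bullet> (M *v b)"
  by (auto simp: bilin_def inner_vec_def matrix_vector_mult_def sum_distrib_left mult.assoc intro!: sum.cong)

lemma bilin_bound:
  assumes "a \<in> prob_simplex" "b \<in> prob_simplex"
  shows "\<bar>bilin M a b\<bar> \<le> entry_bound M"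
  unfolding bilin_def entry_bound_def
proof (rule order_trans[OF sum_abs], rule sum_mono, rule order_trans[OF sum_abs], rule sum_mono)
  fix i j
  have "\<bar>a $ i\<bar> * \<bar>M $ i $ j\<bar> * \<bar>b $ j\<bar> \<le> 1 * \<bar>M $ i $ j\<bar> * 1"
    using assms by (intro mult_mono) (auto simp: prob_simplex_le1 prob_simplexD)
  then show "\<bar>a $ i * M $ i $ j * b $ j\<bar> \<le> \<bar>M $ i $ j\<bar>" by (simp add: abs_mult)
qed

text \<open>The substantial half of von Neumann's theorem: replies that may depend on
  \<open>b\<close> are exchanged for a single action. With \<open>S\<close> the convex set of payoff
  vectors, indexed by the pure actions of player 1, the separating probability vector is itself that
  action.\<close>

lemma average_value_ge:
  fixes G :: "('k::finite, 'l::finite, 'i::finite, 'j::finite) games"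
  assumes w: "\<And>b. b \<in> prob_simplex \<Longrightarrow>
    \<exists>a\<in>prob_simplex. w \<le> (\<Sum>k\<in>UNIV. \<Sum>l\<in>UNIV. \<pi> $ (k, l) * bilin (G k l) a b)"
  shows "w \<le> average_value G \<pi>"
proof -
  define M where "M = (\<Sum>k\<in>UNIV. \<Sum>l\<in>UNIV. \<pi> $ (k, l) *\<^sub>R G k l)"
  have vs: "(\<Sum>x\<in>A. f x) *v b = (\<Sum>x\<in>A. f x *v b)" for f :: "'x \<Rightarrow> real^'j^'i" and b :: "real^'j" and A
    by (induction A rule: infinite_finite_induct) (auto simp: matrix_vector_mult_add_rdistrib)
  have M: "(\<Sum>k\<in>UNIV. \<Sum>l\<in>UNIV. \<pi> $ (k, l) * bilin (G k l) a b) = bilin M a b" for a b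
    by (simp add: bilin_conv_inner M_def vs inner_sum_right scaleR_matrix_vector_assoc[symmetric])
  define S :: "(real^'i) set" where "S = (\<lambda>b. M *v b) ` prob_simplex"
  have "convex S" unfolding S_def by (intro convex_linear_image convex_prob_simplex) auto
  moreover have "\<exists>i. (w *\<^sub>R 1) $ i \<le> x $ i" if x: "x \<in> S" for x :: "real^'i"
  proof -
    obtain b where b: "b \<in> prob_simplex" "x = M *v b" using x by (auto simp: S_def)
    obtain a where a: "a \<in> prob_simplex" "w \<le> a \<bullet> x"
      using w[OF b(1)] unfolding M unfolding bilin_conv_inner b(2) by blast
    show ?thesis
    \<comment> \<open>The weighted average \<open>a \<bullet> x\<close> cannot reach
      \<open>w\<close> if all coordinates of \<open>x\<close> stay below \<open>w\<close>.\<close>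
    proof (rule ccontr)
      assume "\<not> ?thesis"
      then have lt: "x $ i < w" for i by (auto simp: not_le)
      have "Max (range (($) x)) < w" using lt by (subst Max_less_iff) auto
      moreover have "a \<bullet> x \<le> Max (range (($) x))"
        using a by (intro inner_le_in_prob_simplex) auto
      ultimately show False using a by linarith
    qed
  qed
  ultimately obtain p where p: "p \<in> prob_simplex" "\<And>x. x \<in> S \<Longrightarrow> p \<bullet> (w *\<^sub>R 1) \<le> p \<bullet> x"
    using separating_prob_vector[of S "w *\<^sub>R 1"] by blast
  have pw: "p \<bullet> (w *\<^sub>R 1) = w" using p by (simp add: inner_vec_def prob_simplexD flip: sum_distrib_right)
  have "w \<le> (INF b\<in>prob_simplex. bilin M p b)"
    using p pw by (intro cINF_greatest prob_simplex_nonempty) (auto simp: S_def bilin_conv_inner)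
  also have "\<dots> \<le> (SUP a\<in>prob_simplex. INF b\<in>prob_simplex. bilin M a b)"
  proof (rule cSUP_upper[OF p(1)])
    obtain b :: "real^'j" where b: "b \<in> prob_simplex" using prob_simplex_nonempty by blast
    have "(INF b\<in>prob_simplex. bilin M a b) \<le> entry_bound M" if "a \<in> prob_simplex" for a
    proof (rule cINF_lower2[OF _ b])
      show "bdd_below (bilin M a ` prob_simplex)"
        using that bilin_bound[of a _ M] by (intro bdd_belowI2[where m="- entry_bound M"]) force
      show "bilin M a b \<le> entry_bound M" using bilin_bound[OF that b, of M] by linarith
    qed
    then show "bdd_above ((\<lambda>a. INF b\<in>prob_simplex. bilin M a b) ` prob_simplex)"
      by (intro bdd_aboveI2)
  qed
  finally show ?thesis by (simp add: average_value_def M)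
qed

subsection \<open>Moving averages on the unit interval\<close>

abbreviation L01 :: "real measure" where "L01 \<equiv> lebesgue_on {0..1}"

lemma prob_space_L01: "prob_space L01"
  by (rule prob_spaceI) (simp add: emeasure_restrict_space)

lemma integrable_L01_bounded:
  fixes f :: "real \<Rightarrow> real"
  assumes "f \<in> borel_measurable L01" "\<And>s. s \<in> {0..1} \<Longrightarrow> \<bar>f s\<bar> \<le> B"
  shows "integrable L01 f"
proof -
  interpret prob_space L01 by (rule prob_space_L01)
  show ?thesis using assms by (intro integrable_const_bound[where B=B] AE_I2) auto
qed

lemma integral_L01_abs_le:
  fixes f :: "real \<Rightarrow> real"
  assumes "\<And>s. s \<in> {0..1} \<Longrightarrow> \<bar>f s\<bar> \<le> B" "0 \<le> B"
  shows "\<bar>LINT s|L01. f s\<bar> \<le> B"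
proof (cases "integrable L01 f")
  case True
  interpret prob_space L01 by (rule prob_space_L01)
  have "(LINT s|L01. f s) \<le> B" "- B \<le> (LINT s|L01. f s)"
    using assms True by (intro integral_le_const integral_ge_const AE_I2; force)+
  then show ?thesis by auto
qed (use assms in \<open>auto simp: not_integrable_integral_eq\<close>)

lemma borel_measurable_L01I: "f \<in> borel_measurable borel \<Longrightarrow> f \<in> borel_measurable L01"
  by (simp add: measurable_completion measurable_restrict_space1)

text \<open>Lebesgue's differentiation theorem for the extension of \<open>f\<close> by zero. The
  extension also accounts for windows that reach beyond 1.\<close>

lemma moving_averages_tendsto_AE:
  fixes f :: "real \<Rightarrow> real"
  assumes f: "integrable L01 f"
  shows "AE t in L01. (\<lambda>n. real (Suc n) * (LINT s|L01. indicator {t..t + 1 / Suc n} s * f s)) \<longlonglongrightarrow> f t"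
proof -
  define f' where "f' s = (if s \<in> {0..1} then f s else 0)" for s
  have "f integrable_on {0..1}"
    using f by (rule integrable_on_lebesgue_on) auto
  then have "f' integrable_on UNIV" by (simp only: f'_def[abs_def] integrable_restrict_UNIV)
  then have f': "f' integrable_on cbox a b" for a b
    by (rule integrable_on_subcbox) auto
  obtain N where N: "negligible N" and lim: "\<And>x e. \<lbrakk>x \<notin> N; 0 < e\<rbrakk> \<Longrightarrow>
     \<exists>d>0. \<forall>h. 0 < h \<and> h < d \<longrightarrow> norm (integral (cbox x (x + h *\<^sub>R One)) f' /\<^sub>R h ^ DIM(real) - f' x) < e"
    using integrable_ccontinuous_explicit[of f', OF f'] by metis
  have int_eq: "(LINT s|L01. indicator {x..y} s * f s) = integral {x..y} f'" for x y
  proof -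
    have m: "{x..y} \<inter> {0..1} \<in> sets L01" by (subst sets_restrict_space_iff) auto
    have "integrable L01 (\<lambda>s. indicator {x..y} s * f s)"
      using integrable_mult_indicator[OF m f]
      by (subst Bochner_Integration.integrable_cong[OF refl, of _ _ "\<lambda>s. indicator ({x..y} \<inter> {0..1}) s *\<^sub>R f s"])
         (auto simp: indicator_def)
    then have "(LINT s|L01. indicator {x..y} s * f s) = integral {0..1} (\<lambda>s. indicator {x..y} s * f s)"
      by (rule lebesgue_integral_eq_integral) auto
    also have "\<dots> = integral UNIV (\<lambda>s. if s \<in> {0..1} then indicator {x..y} s * f s else 0)"
      by (simp only: integral_restrict_UNIV)
    also have "\<dots> = integral UNIV (\<lambda>s. if s \<in> {x..y} then f' s else 0)"
      by (intro arg_cong2[where f=integral]) (auto simp: f'_def)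
    finally show ?thesis by (simp only: integral_restrict_UNIV)
  qed
  have "(\<lambda>n. real (Suc n) * (LINT s|L01. indicator {t..t + 1 / Suc n} s * f s)) \<longlonglongrightarrow> f t"
    if t: "t \<notin> N" "t \<in> {0..1}" for t
  proof (rule LIMSEQ_I)
    fix e :: real assume "e > 0"
    from lim[OF t(1) this] obtain d where d: "d > 0" and
      D: "\<And>h. 0 < h \<Longrightarrow> h < d \<Longrightarrow> \<bar>integral {t..t+h} f' / h - f' t\<bar> < e"
      by (auto simp: divide_inverse mult.commute)
    obtain n0 where n0: "1 / real (Suc n0) < d" using d reals_Archimedean by (metis inverse_eq_divide)
    have "norm (real (Suc n) * (LINT s|L01. indicator {t..t + 1 / Suc n} s * f s) - f t) < e" if "n \<ge> n0" for n
    proof -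
      have "1 / real (Suc n) \<le> 1 / real (Suc n0)" using that by (intro divide_left_mono) auto
      then have "1 / real (Suc n) < d" using n0 by linarith
      from D[OF _ this] show ?thesis unfolding int_eq using t by (simp add: f'_def mult.commute)
    qed
    then show "\<exists>n0. \<forall>n\<ge>n0. norm (real (Suc n) * (LINT s|L01. indicator {t..t + 1 / Suc n} s * f s) - f t) < e"
      by blast
  qed
  then show ?thesis
    using N by (subst AE_restrict_space_iff) (auto simp: negligible_iff_null_sets intro!: AE_I'[of N])
qed

text \<open>Continuity in the left end of the window allows the average at a variable time to be
  replaced by its values on a grid, that is, by finitely many functionals of
  \<open>f\<close>.\<close>

lemma moving_average_measurable_bound:
  fixes f :: "real \<Rightarrow> real"
  assumes f: "f \<in> borel_measurable L01" "\<And>s. s \<in> {0..1} \<Longrightarrow> \<bar>f s\<bar> \<le> 1"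
  shows moving_average_tendsto: "x \<longlonglongrightarrow> t \<Longrightarrow>
      (\<lambda>m. LINT s|L01. indicator {x m..x m + h} s * f s) \<longlonglongrightarrow> (LINT s|L01. indicator {t..t + h} s * f s)"
    and moving_average_bound: "h \<ge> 0 \<Longrightarrow> \<bar>LINT s|L01. indicator {t..t + h} s * f s\<bar> \<le> h"
proof -
  note [measurable] = f(1)
  have ind[measurable]: "(\<lambda>s. indicator {t..u} s :: real) \<in> borel_measurable L01" for t u :: real
    by (rule borel_measurable_L01I) auto
  interpret prob_space L01 by (rule prob_space_L01)
  show "(\<lambda>m. LINT s|L01. indicator {x m..x m + h} s * f s) \<longlonglongrightarrow> (LINT s|L01. indicator {t..t + h} s * f s)"
    if x: "x \<longlonglongrightarrow> t"
  proof (rule integral_dominated_convergence[where w="\<lambda>_. 1"])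
    have "(\<lambda>m. indicator {x m..x m + h} s * f s) \<longlonglongrightarrow> indicator {t..t + h} s * f s"
      if "s \<noteq> t" "s \<noteq> t + h" for s
    proof -
      have xh: "(\<lambda>m. x m + h) \<longlonglongrightarrow> t + h" by (intro tendsto_intros x)
      have "\<forall>\<^sub>F m in sequentially. (x m \<le> s) = (t \<le> s)"
        using order_tendstoD[OF x, of s] that by (cases "t < s") (auto elim!: eventually_mono)
      moreover have "\<forall>\<^sub>F m in sequentially. (s \<le> x m + h) = (s \<le> t + h)"
        using order_tendstoD[OF xh, of s] that by (cases "t + h < s") (auto elim!: eventually_mono)
      ultimately have "\<forall>\<^sub>F m in sequentially. indicator {x m..x m + h} s * f s = indicator {t..t + h} s * f s"
        by eventually_elim (auto simp: indicator_def)
      then show ?thesis by (rule tendsto_eventually)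
    qed
    then show "AE s in L01. (\<lambda>m. indicator {x m..x m + h} s * f s) \<longlonglongrightarrow> indicator {t..t + h} s * f s"
      by (subst AE_restrict_space_iff) (auto intro!: AE_I'[of "{t, t+h}"])
    show "AE s in L01. norm (indicator {x m..x m + h} s * f s) \<le> 1" for m
      using f(2) by (intro AE_I2) (auto simp: indicator_def)
  qed auto
  show "\<bar>LINT s|L01. indicator {t..t + h} s * f s\<bar> \<le> h" if h: "h \<ge> 0"
  proof -
    have "\<bar>LINT s|L01. indicator {t..t + h} s * f s\<bar> \<le> (LINT s|L01. \<bar>indicator {t..t + h} s * f s\<bar>)"
      by (rule integral_abs_bound)
    also have "\<dots> \<le> (LINT s|L01. indicator {t..t + h} s)"
    proof (rule Bochner_Integration.integral_mono)
      show "integrable L01 (\<lambda>s. \<bar>indicator {t..t + h} s * f s\<bar>)"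
        by (rule integrable_L01_bounded[where B=1], intro borel_measurable_abs borel_measurable_times ind f(1))
           (use f(2) in \<open>auto simp: indicator_def\<close>)
      show "integrable L01 (\<lambda>s. indicator {t..t + h} s :: real)"
        by (rule integrable_L01_bounded[where B=1], rule ind) (auto simp: indicator_def)
    qed (use f(2) in \<open>auto simp: indicator_def\<close>)
    also have "\<dots> = measure L01 ({t..t+h} \<inter> {0..1})"
      by (simp only: Bochner_Integration.integral_indicator) simp
    also have "\<dots> = measure lebesgue ({t..t+h} \<inter> {0..1})"
      by (intro measure_restrict_space) auto
    also have "\<dots> \<le> measure lebesgue {t..t+h}"
      by (intro measure_mono_fmeasurable) auto
    also have "\<dots> = h" using h by simp
    finally show ?thesis .
  qed
qed

lemma integral_times_step_function:
  fixes f :: "real \<Rightarrow> real"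
  assumes f: "f \<in> borel_measurable L01" "\<And>s. s \<in> {0..1} \<Longrightarrow> \<bar>f s\<bar> \<le> 1"
  shows "(LINT s|L01. F (nat \<lfloor>real m * s\<rfloor>) * f s) =
    (\<Sum>k\<le>m. F k * (LINT s|L01. indicator {s. nat \<lfloor>real m * s\<rfloor> = k} s * f s))"
proof -
  have ind[measurable]: "(\<lambda>s. indicator {s. nat \<lfloor>real m * s\<rfloor> = k} s :: real) \<in> borel_measurable L01" for k
    by (rule borel_measurable_L01I) measurable
  note [measurable] = f(1)
  have "(LINT s|L01. F (nat \<lfloor>real m * s\<rfloor>) * f s) =
     (LINT s|L01. (\<Sum>k\<le>m. F k * (indicator {s. nat \<lfloor>real m * s\<rfloor> = k} s * f s)))"
  proof (rule Bochner_Integration.integral_cong[OF refl])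
    fix s assume "s \<in> space L01"
    then have s: "0 \<le> s" "s \<le> 1" by auto
    \<comment> \<open>For positive \<open>m\<close> the cell with index \<open>m\<close> meets [0,1]
      only in the point 1; the sum runs up to \<open>m\<close> inclusive in order to catch that
      point.\<close>
    then have "real m * s \<le> real m" by (simp add: mult_left_le)
    then have "nat \<lfloor>real m * s\<rfloor> \<le> m" by linarith
    then show "F (nat \<lfloor>real m * s\<rfloor>) * f s = (\<Sum>k\<le>m. F k * (indicator {s. nat \<lfloor>real m * s\<rfloor> = k} s * f s))"
    proof -
      have "(\<Sum>k\<le>m. F k * (indicator {s. nat \<lfloor>real m * s\<rfloor> = k} s * f s)) =
        (\<Sum>k\<le>m. if k = nat \<lfloor>real m * s\<rfloor> then F k * f s else 0)"
        by (intro sum.cong) auto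
      then show ?thesis using \<open>nat \<lfloor>real m * s\<rfloor> \<le> m\<close> by simp
    qed
  qed
  also have "\<dots> = (\<Sum>k\<le>m. LINT s|L01. F k * (indicator {s. nat \<lfloor>real m * s\<rfloor> = k} s * f s))"
  proof (intro Bochner_Integration.integral_sum integrable_mult_right)
    show "integrable L01 (\<lambda>s. indicator {s. nat \<lfloor>real m * s\<rfloor> = k} s * f s)" for k
      by (rule integrable_L01_bounded[where B=1], intro borel_measurable_times ind f(1))
         (use f(2) in \<open>auto simp: indicator_def\<close>)
  qed
  finally show ?thesis by simp
qed

text \<open>The integral of a product becomes an iterated limit of finite sums in which each summand
  is a functional of \<open>f\<close> times a functional of \<open>g\<close>. The grid is refined
  first, with the window of the average fixed, and the window shrinks afterwards.\<close>

lemma integral_product_limits: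
  fixes f g :: "real \<Rightarrow> real"
  assumes f: "f \<in> borel_measurable L01" "\<And>s. s \<in> {0..1} \<Longrightarrow> \<bar>f s\<bar> \<le> 1"
    and g: "g \<in> borel_measurable L01" "\<And>s. s \<in> {0..1} \<Longrightarrow> \<bar>g s\<bar> \<le> 1"
  defines "A \<equiv> \<lambda>n t. real (Suc n) * (LINT s|L01. indicator {t..t + 1 / Suc n} s * f s)"
  shows product_limit_inner: "(\<lambda>m. \<Sum>k\<le>m. A n (real k / real m) * (LINT s|L01. indicator {s. nat \<lfloor>real m * s\<rfloor> = k} s * g s))
      \<longlonglongrightarrow> (LINT s|L01. A n s * g s)" (is "?inner \<longlonglongrightarrow> _")
    and product_limit_outer: "(\<lambda>n. LINT s|L01. A n s * g s) \<longlonglongrightarrow> (LINT s|L01. f s * g s)"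
proof -
  note [measurable] = f(1) g(1)
  interpret prob_space L01 by (rule prob_space_L01)
  have bd: "\<bar>A n t\<bar> \<le> 1" for n t
  proof -
    have "real (Suc n) * \<bar>LINT s|L01. indicator {t..t + 1 / Suc n} s * f s\<bar> \<le> real (Suc n) * (1 / Suc n)"
      by (intro mult_left_mono moving_average_bound f) auto
    then show ?thesis by (simp add: A_def abs_mult)
  qed
  have lim: "(\<lambda>m. A n (real (nat \<lfloor>real m * s\<rfloor>) / real m)) \<longlonglongrightarrow> A n s" if s: "s \<in> {0..1}" for n s
  proof -
    have "(\<lambda>m. real (nat \<lfloor>real m * s\<rfloor>) / real m) \<longlonglongrightarrow> s"
    proof (rule real_tendsto_sandwich[where f="\<lambda>m. s - 1 / real m" and h="\<lambda>m. s"])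
      show "\<forall>\<^sub>F m in sequentially. s - 1 / real m \<le> real (nat \<lfloor>real m * s\<rfloor>) / real m"
        using eventually_gt_at_top[of 0]
      proof eventually_elim
        case (elim m)
        have "real m * s - 1 \<le> real (nat \<lfloor>real m * s\<rfloor>)" by linarith
        then have "(real m * s - 1) / real m \<le> real (nat \<lfloor>real m * s\<rfloor>) / real m"
          by (rule divide_right_mono) auto
        then show ?case using elim by (simp add: diff_divide_distrib)
      qed
      show "\<forall>\<^sub>F m in sequentially. real (nat \<lfloor>real m * s\<rfloor>) / real m \<le> s"
        using eventually_gt_at_top[of 0]
      proof eventually_elim
        case (elim m)
        have "0 \<le> real m * s" using s by simp
        then have "real (nat \<lfloor>real m * s\<rfloor>) \<le> real m * s" by linarith
        then show ?case using elim by (simp add: field_simps)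
      qed
      have "(\<lambda>m. s - 1 / real m) \<longlonglongrightarrow> s - 0" by (intro tendsto_intros lim_1_over_n)
      then show "(\<lambda>m. s - 1 / real m) \<longlonglongrightarrow> s" by simp
    qed auto
    then show ?thesis unfolding A_def by (intro tendsto_intros moving_average_tendsto f)
  qed
  have step_meas[measurable]: "(\<lambda>s. A n (real (nat \<lfloor>real m * s\<rfloor>) / real m)) \<in> borel_measurable L01" for n m
    by (rule borel_measurable_L01I) measurable
  have A_meas[measurable]: "A n \<in> borel_measurable L01" for n
    by (rule borel_measurable_LIMSEQ_real[OF lim step_meas]) simp
  have eq: "(\<Sum>k\<le>m. A n (real k / real m) * (LINT s|L01. indicator {s. nat \<lfloor>real m * s\<rfloor> = k} s * g s)) = (LINT s|L01. A n (real (nat \<lfloor>real m * s\<rfloor>) / real m) * g s)" for m n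
    by (rule integral_times_step_function[OF g, of "\<lambda>k. A n (real k / real m)" m, symmetric])
  have le1: "\<bar>x * y\<bar> \<le> 1" if "\<bar>x\<bar> \<le> 1" "\<bar>y\<bar> \<le> 1" for x y :: real
    using mult_mono[OF that] by (simp add: abs_mult)
  show "?inner \<longlonglongrightarrow> (LINT s|L01. A n s * g s)"
    unfolding eq
    by (rule integral_dominated_convergence[where w="\<lambda>_. 1"])
       (auto intro!: AE_I2 tendsto_intros lim le1 bd g)
  show "(\<lambda>n. LINT s|L01. A n s * g s) \<longlonglongrightarrow> (LINT s|L01. f s * g s)"
  proof (rule integral_dominated_convergence[where w="\<lambda>_. 1"])
    have "integrable L01 f" using f by (rule integrable_L01_bounded)
    from moving_averages_tendsto_AE[OF this]
    show "AE s in L01. (\<lambda>n. A n s * g s) \<longlonglongrightarrow> f s * g s"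
      unfolding A_def by eventually_elim (auto intro!: tendsto_intros)
  qed (auto intro!: AE_I2 le1 bd g)
qed

subsection \<open>Measurability on the space of controls\<close>

lemma controls_simplex: "u \<in> controls \<Longrightarrow> s \<in> {0..1} \<Longrightarrow> u s \<in> prob_simplex"
  by (auto simp: controls_def PiE_iff)

lemma controls_measurable: "u \<in> controls \<Longrightarrow> u \<in> borel_measurable L01"
  by (auto simp: controls_def)

lemma controls_nth_measurable: "u \<in> controls \<Longrightarrow> (\<lambda>s. u s $ i) \<in> borel_measurable L01"
  using measurable_compose[OF controls_measurable, of u "\<lambda>x. x $ i" borel]
  by (simp add: borel_measurable_continuous_onI continuous_on_component)

lemma controls_nth_bound: "u \<in> controls \<Longrightarrow> s \<in> {0..1} \<Longrightarrow> \<bar>u s $ i\<bar> \<le> 1"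
  using controls_simplex[of u s] prob_simplex_le1 prob_simplexD(1)[of "u s" i] by (auto simp: abs_le_iff)

lemma const_in_controls: "b \<in> prob_simplex \<Longrightarrow> (\<lambda>s\<in>{0..1}. b) \<in> controls"
  by (subst controls_def, auto simp: restrict_def) (subst measurable_cong[where g="\<lambda>_. b"], auto)

lemma norm_le_1_prob_simplex: "x \<in> prob_simplex \<Longrightarrow> norm x \<le> 1"
  using norm_le_l1_cart[of x] by (simp add: prob_simplexD)

lemma integrable_control_diff:
  assumes "u \<in> controls" "v \<in> controls"
  shows "integrable L01 (\<lambda>s. norm (u s - v s))"
proof (rule integrable_L01_bounded[where B=2])
  show "(\<lambda>s. norm (u s - v s)) \<in> borel_measurable L01"
    using assms[THEN controls_measurable] by measurable
  show "\<bar>norm (u s - v s)\<bar> \<le> 2" if "s \<in> {0..1}" for s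
    using norm_triangle_ineq4[of "u s" "v s"] norm_le_1_prob_simplex[OF controls_simplex[OF assms(1) that]]
      norm_le_1_prob_simplex[OF controls_simplex[OF assms(2) that]] by simp
qed

lemma integrable_control_weighted:
  assumes "u \<in> controls" "w \<in> borel_measurable L01" "\<And>s. s \<in> {0..1} \<Longrightarrow> \<bar>w s\<bar> \<le> 1"
  shows "integrable L01 (\<lambda>s. w s * u s $ i)"
proof (rule integrable_L01_bounded[where B=1])
  show "(\<lambda>s. w s * u s $ i) \<in> borel_measurable L01"
    using assms by (intro borel_measurable_times controls_nth_measurable)
  show "\<bar>w s * u s $ i\<bar> \<le> 1" if s: "s \<in> {0..1}" for s
    using mult_mono[OF assms(3)[OF s] controls_nth_bound[OF assms(1) s, of i]] by (simp add: abs_mult)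
qed

lemma weighted_integral_lipschitz:
  assumes u: "u \<in> controls" and v: "v \<in> controls"
    and w: "w \<in> borel_measurable L01" "\<And>s. s \<in> {0..1} \<Longrightarrow> \<bar>w s\<bar> \<le> 1"
  shows "\<bar>(LINT s|L01. w s * u s $ i) - (LINT s|L01. w s * v s $ i)\<bar> \<le> L1_dist u v"
proof -
  have "\<bar>(LINT s|L01. w s * u s $ i) - (LINT s|L01. w s * v s $ i)\<bar> =
    \<bar>LINT s|L01. w s * u s $ i - w s * v s $ i\<bar>"
    by (subst Bochner_Integration.integral_diff) (auto intro!: integrable_control_weighted assms)
  also have "\<dots> \<le> (LINT s|L01. \<bar>w s * u s $ i - w s * v s $ i\<bar>)"
    by (rule integral_abs_bound)
  also have "\<dots> \<le> (LINT s|L01. norm (u s - v s))"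
  proof (rule Bochner_Integration.integral_mono)
    show "integrable L01 (\<lambda>s. \<bar>w s * u s $ i - w s * v s $ i\<bar>)"
      by (intro integrable_abs Bochner_Integration.integrable_diff integrable_control_weighted assms)
    fix s assume "s \<in> space L01"
    then have s: "s \<in> {0..1}" by simp
    have "\<bar>w s * u s $ i - w s * v s $ i\<bar> = \<bar>w s\<bar> * \<bar>(u s - v s) $ i\<bar>"
      by (simp add: abs_mult flip: right_diff_distrib)
    also have "\<dots> \<le> 1 * norm (u s - v s)"
      by (intro mult_mono w(2) s component_le_norm_cart) auto
    finally show "\<bar>w s * u s $ i - w s * v s $ i\<bar> \<le> norm (u s - v s)" by simp
  qed (rule integrable_control_diff[OF u v])
  finally show ?thesis by (simp add: L1_dist_def)
qed

lemma space_control_borel [simp]: "space control_borel = controls"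
  unfolding control_borel_def by (rule space_measure_of) auto

lemma open_in_control_borel:
  assumes "A \<subseteq> controls" "\<And>f. f \<in> A \<Longrightarrow> \<exists>e>0. \<forall>g\<in>controls. L1_dist f g < e \<longrightarrow> g \<in> A"
  shows "A \<in> sets control_borel"
  unfolding control_borel_def using assms by (subst sets_measure_of) auto

text \<open>The generators of \<open>control_borel\<close> are the sets open for
  \<open>L1_dist\<close>, so preimages of open sets are generators. Integrals of a coordinate
  against a weight bounded by 1 satisfy the condition.\<close>

lemma borel_measurable_control_lipschitz:
  fixes f :: "'n::finite control \<Rightarrow> real"
  assumes f: "\<And>u v. u \<in> controls \<Longrightarrow> v \<in> controls \<Longrightarrow> \<bar>f u - f v\<bar> \<le> L1_dist u v"
  shows "f \<in> borel_measurable control_borel"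
proof (rule borel_measurableI)
  fix S :: "real set" assume S: "open S"
  show "f -` S \<inter> space control_borel \<in> sets control_borel"
  proof (rule open_in_control_borel)
    fix u assume u: "u \<in> f -` S \<inter> space control_borel"
    then obtain e where e: "e > 0" "\<And>y. dist y (f u) < e \<Longrightarrow> y \<in> S"
      using S unfolding open_dist by auto
    have "g \<in> f -` S" if "g \<in> controls" "L1_dist u g < e" for g
      using f[of u g] u that e(2)[of "f g"] by (auto simp: dist_real_def)
    then show "\<exists>e>0. \<forall>g\<in>controls. L1_dist u g < e \<longrightarrow> g \<in> f -` S \<inter> space control_borel"
      using e by (auto intro!: exI[of _ e])
  qed auto
qed

lemma measurable_control_lipschitz:
  fixes T :: "'n::finite control \<Rightarrow> 'm::finite control"
  assumes T: "\<And>u. u \<in> controls \<Longrightarrow> T u \<in> controls"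
    and C: "\<And>u v. u \<in> controls \<Longrightarrow> v \<in> controls \<Longrightarrow> L1_dist (T u) (T v) \<le> C * L1_dist u v" "0 < C"
  shows "T \<in> measurable control_borel control_borel"
proof -
  have "T \<in> measurable control_borel (sigma controls
     {A. A \<subseteq> controls \<and> (\<forall>f\<in>A. \<exists>e>0. \<forall>g\<in>controls. L1_dist f g < e \<longrightarrow> g \<in> A)})"
  proof (rule measurable_measure_of)
    fix A :: "'m control set" assume "A \<in> {A. A \<subseteq> controls \<and> (\<forall>f\<in>A. \<exists>e>0. \<forall>g\<in>controls. L1_dist f g < e \<longrightarrow> g \<in> A)}"
    then have A: "A \<subseteq> controls" "\<And>f. f \<in> A \<Longrightarrow> \<exists>e>0. \<forall>g\<in>controls. L1_dist f g < e \<longrightarrow> g \<in> A" by auto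
    show "T -` A \<inter> space control_borel \<in> sets control_borel"
    proof (rule open_in_control_borel)
      fix u assume u: "u \<in> T -` A \<inter> space control_borel"
      then obtain e where e: "e > 0" "\<And>g. g \<in> controls \<Longrightarrow> L1_dist (T u) g < e \<Longrightarrow> g \<in> A"
        using A(2)[of "T u"] by auto
      have "T g \<in> A" if g: "g \<in> controls" "L1_dist u g < e / C" for g
      proof (rule e(2))
        have "L1_dist (T u) (T g) \<le> C * L1_dist u g" using C u g by simp
        also have "\<dots> < C * (e / C)" using g C(2) by (intro mult_strict_left_mono)
        finally show "L1_dist (T u) (T g) < e" using C(2) by simp
      qed (use T g in auto)
      then show "\<exists>e>0. \<forall>g\<in>controls. L1_dist u g < e \<longrightarrow> g \<in> T -` A \<inter> space control_borel"
        using e C(2) by (auto intro!: exI[of _ "e / C"])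
    qed auto
  qed (use T in auto)
  then show ?thesis by (simp add: control_borel_def)
qed

lemma weighted_integral_measurable:
  assumes "w \<in> borel_measurable L01" "\<And>s. s \<in> {0..1} \<Longrightarrow> \<bar>w s\<bar> \<le> 1"
  shows "(\<lambda>u. LINT s|L01. w s * u s $ i) \<in> borel_measurable control_borel"
  by (intro borel_measurable_control_lipschitz weighted_integral_lipschitz assms)

lemma indicator_integral_measurable:
  assumes "A \<in> sets borel"
  shows "(\<lambda>u. LINT s|L01. indicator A s * u s $ i) \<in> borel_measurable control_borel"
proof (rule weighted_integral_measurable)
  show "(\<lambda>s. indicator A s :: real) \<in> borel_measurable L01"
    using assms by (intro borel_measurable_L01I) auto
qed (auto simp: indicator_def)

text \<open>The functional is continuous in the pair, but continuity yields measurability for the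
  Borel sets of the product topology, not at once for the product sigma-algebra. The iterated limit
  of sums of products settles the latter directly.\<close>

lemma product_integral_measurable:
  "(\<lambda>(u, v). LINT s|L01. u s $ i * v s $ j) \<in> borel_measurable (control_borel \<Otimes>\<^sub>M control_borel)"
  for i :: "'i::finite" and j :: "'j::finite"
proof -
  define A where "A = (\<lambda>(n::nat) t (u::'i control). real (Suc n) * (LINT s|L01. indicator {t..t + 1 / Suc n} s * u s $ i))"
  define B where "B = (\<lambda>(m::nat) k (v::'j control). LINT s|L01. indicator {s. nat \<lfloor>real m * s\<rfloor> = k} s * v s $ j)"
  have [measurable]: "A n t \<in> borel_measurable control_borel" for n t
    unfolding A_def by (intro borel_measurable_times borel_measurable_const indicator_integral_measurable) auto
  have [measurable]: "B m k \<in> borel_measurable control_borel" for m k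
    unfolding B_def by (rule indicator_integral_measurable) simp
  have lim1: "(\<lambda>m. \<Sum>k\<le>m. A n (real k / real m) u * B m k v) \<longlonglongrightarrow> (LINT s|L01. A n s u * v s $ j)"
    and lim2: "(\<lambda>n. LINT s|L01. A n s u * v s $ j) \<longlonglongrightarrow> (LINT s|L01. u s $ i * v s $ j)"
    if uv: "u \<in> controls" "v \<in> controls" for u v n
    unfolding A_def B_def
    by (rule product_limit_inner product_limit_outer;
        rule controls_nth_measurable controls_nth_bound; (rule uv | assumption))+
  have m1: "(\<lambda>x. LINT s|L01. A n s (fst x) * snd x s $ j) \<in> borel_measurable (control_borel \<Otimes>\<^sub>M control_borel)" for n
  proof (rule borel_measurable_LIMSEQ_real)
    show "(\<lambda>m. \<Sum>k\<le>m. A n (real k / real m) (fst x) * B m k (snd x)) \<longlonglongrightarrow> (LINT s|L01. A n s (fst x) * snd x s $ j)"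
      if "x \<in> space (control_borel \<Otimes>\<^sub>M control_borel)" for x
      using that by (intro lim1) (auto simp: space_pair_measure)
  qed measurable
  show ?thesis
    unfolding case_prod_beta
    by (rule borel_measurable_LIMSEQ_real[OF _ m1]) (auto simp: space_pair_measure intro!: lim2)
qed

section \<open>The running payoff of two controls\<close>

definition running_payoff :: "real ^ 'j::finite ^ 'i::finite \<Rightarrow> 'i control \<Rightarrow> 'j control \<Rightarrow> real" where
  "running_payoff M u v = (LINT s|L01. bilin M (u s) (v s))"

lemma integrable_bilin_controls:
  assumes "u \<in> controls" "v \<in> controls"
  shows "integrable L01 (\<lambda>s. bilin M (u s) (v s))"
proof (rule integrable_L01_bounded[where B="entry_bound M"])
  show "(\<lambda>s. bilin M (u s) (v s)) \<in> borel_measurable L01"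
    unfolding bilin_def
    by (intro borel_measurable_sum borel_measurable_times borel_measurable_const controls_nth_measurable assms)
qed (intro bilin_bound controls_simplex assms)

lemma running_payoff_bound:
  assumes "u \<in> controls" "v \<in> controls"
  shows "\<bar>running_payoff M u v\<bar> \<le> entry_bound M"
  unfolding running_payoff_def
  by (intro integral_L01_abs_le bilin_bound controls_simplex assms entry_bound_nonneg)

lemma running_payoff_measurable:
  "(\<lambda>(u, v). running_payoff M u v) \<in> borel_measurable (control_borel \<Otimes>\<^sub>M control_borel)"
proof -
  have int: "integrable L01 (\<lambda>s. u s $ i * M $ i $ j * v s $ j)"
    if "u \<in> controls" "v \<in> controls" for i j u v
  proof -
    have "integrable L01 (\<lambda>s. M $ i $ j * (u s $ i * v s $ j))"
      using that by (intro integrable_mult_right integrable_control_weighted controls_nth_measurable controls_nth_bound)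
    then show ?thesis by (simp add: mult_ac)
  qed
  have eq: "running_payoff M u v = (\<Sum>i\<in>UNIV. \<Sum>j\<in>UNIV. M $ i $ j * (LINT s|L01. u s $ i * v s $ j))"
    if "u \<in> controls" "v \<in> controls" for u v
    unfolding running_payoff_def bilin_def
  proof -
    have "(LINT s|L01. u s $ i * M $ i $ j * v s $ j) = M $ i $ j * (LINT s|L01. u s $ i * v s $ j)" for i j
    proof -
      have "(LINT s|L01. u s $ i * M $ i $ j * v s $ j) = (LINT s|L01. M $ i $ j * (u s $ i * v s $ j))"
        by (rule Bochner_Integration.integral_cong) (simp_all only: mult_ac)
      then show ?thesis by (simp only: integral_mult_right_zero)
    qed
    then show "(LINT s|L01. (\<Sum>i\<in>UNIV. \<Sum>j\<in>UNIV. u s $ i * M $ i $ j * v s $ j)) =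
        (\<Sum>i\<in>UNIV. \<Sum>j\<in>UNIV. M $ i $ j * (LINT s|L01. u s $ i * v s $ j))"
      by (simp only: Bochner_Integration.integral_sum Bochner_Integration.integrable_sum int[OF that])
  qed
  have "(\<lambda>x. \<Sum>i\<in>UNIV. \<Sum>j\<in>UNIV. M $ i $ j * (\<lambda>(u, v). LINT s|L01. u s $ i * v s $ j) x)
      \<in> borel_measurable (control_borel \<Otimes>\<^sub>M control_borel)"
    by (intro borel_measurable_sum borel_measurable_times borel_measurable_const product_integral_measurable)
  then show ?thesis
    by (rule measurable_cong[THEN iffD1, rotated]) (auto simp: eq space_pair_measure)
qed

subsection \<open>Delays and induced pairs\<close>

text \<open>The interval is a premise under the full Lebesgue measure rather than a restriction of
  the measure, so that affine changes of time and comparisons between different intervals stay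
  elementary.\<close>

definition agree :: "real \<Rightarrow> 'n::finite control \<Rightarrow> 'n control \<Rightarrow> bool" where
  "agree t u v \<longleftrightarrow> (AE s in lebesgue. s \<in> {0..t} \<longrightarrow> u s = v s)"

lemma agree_iff: "(AE s in lebesgue_on {0..t}. u s = v s) \<longleftrightarrow> agree t u v"
  unfolding agree_def by (subst AE_restrict_space_iff) auto

lemma agree_refl [simp]: "agree t u u"
  by (simp add: agree_def)

lemma agree_sym: "agree t u v \<Longrightarrow> agree t v u"
  unfolding agree_def by (erule eventually_mono) auto

lemma agree_trans:
  assumes "agree t u v" "agree t v w"
  shows "agree t u w"
  using assms unfolding agree_def by eventually_elim auto

lemma agree_mono: "agree t u v \<Longrightarrow> t' \<le> t \<Longrightarrow> agree t' u v"
  unfolding agree_def by (erule eventually_mono) auto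

lemma agree_0: "agree 0 u v"
  unfolding agree_def by (rule AE_I'[of "{0}"]) auto

lemma running_payoff_cong:
  assumes "agree 1 u u'" "agree 1 v v'" "u \<in> controls" "u' \<in> controls" "v \<in> controls" "v' \<in> controls"
  shows "running_payoff M u v = running_payoff M u' v'"
  unfolding running_payoff_def
proof (rule integral_cong_AE)
  show "AE s in L01. bilin M (u s) (v s) = bilin M (u' s) (v' s)"
    using assms(1,2) unfolding agree_iff[symmetric] by eventually_elim auto
qed (use assms integrable_bilin_controls in \<open>auto intro: borel_measurable_integrable\<close>)

text \<open>
  The delay condition with the partition replaced by a finite set of times. It is monotone in that set,
  so that several strategies can be given a common one.
\<close>

definition delay :: "real set \<Rightarrow> ('n::finite control \<Rightarrow> 'm::finite control) \<Rightarrow> bool" where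
  "delay S a \<longleftrightarrow> (\<forall>v1\<in>controls. \<forall>v2\<in>controls. \<forall>t t'. 0 \<le> t \<longrightarrow> t \<le> t' \<longrightarrow> t' \<le> 1 \<longrightarrow>
     S \<inter> {t<..<t'} = {} \<longrightarrow> agree t v1 v2 \<longrightarrow> agree t' (a v1) (a v2))"

lemma delayD:
  "delay S a \<Longrightarrow> v1 \<in> controls \<Longrightarrow> v2 \<in> controls \<Longrightarrow> agree t v1 v2 \<Longrightarrow> 0 \<le> t \<Longrightarrow> t \<le> t' \<Longrightarrow> t' \<le> 1 \<Longrightarrow>
    S \<inter> {t<..<t'} = {} \<Longrightarrow> agree t' (a v1) (a v2)"
  unfolding delay_def by blast

lemma delay_mono:
  assumes "delay S a" "S \<subseteq> T"
  shows "delay T a"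
  unfolding delay_def using assms(2) by (intro ballI allI impI, intro delayD[OF assms(1)]) auto

text \<open>The case of equal times, where the open interval is empty: \<open>delay\<close> includes
  plain nonanticipativity.\<close>

lemma delay_agree: "delay S a \<Longrightarrow> v1 \<in> controls \<Longrightarrow> v2 \<in> controls \<Longrightarrow> agree 1 v1 v2 \<Longrightarrow> agree 1 (a v1) (a v2)"
  by (rule delayD) auto

section \<open>Finite delay sets versus partitions\<close>

definition partition :: "nat \<Rightarrow> (nat \<Rightarrow> real) \<Rightarrow> bool" where
  "partition N s \<longleftrightarrow> s 0 = 0 \<and> s N = 1 \<and> (\<forall>r<N. s r < s (Suc r))"

lemma partition_less:
  assumes "partition N s" "i < j" "j \<le> N"
  shows "s i < s j"
  using assms(2,3)
proof (induction j)
  case (Suc j)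
  have "s j < s (Suc j)" using assms(1) Suc.prems by (auto simp: partition_def)
  then show ?case using Suc by (cases "i = j") force+
qed simp

lemma partition_le: "partition N s \<Longrightarrow> i \<le> j \<Longrightarrow> j \<le> N \<Longrightarrow> s i \<le> s j"
  using partition_less[of N s i j] by (cases "i = j") auto

lemma partition_bounds: "partition N s \<Longrightarrow> i \<le> N \<Longrightarrow> 0 \<le> s i \<and> s i \<le> 1"
  using partition_le[of N s 0 i] partition_le[of N s i N] by (auto simp: partition_def)

lemma partition_exists:
  assumes "finite S"
  obtains N s where "partition N s" "\<And>r. r < N \<Longrightarrow> S \<inter> {s r<..<s (Suc r)} = {}"
proof -
  define T where "T = insert 0 (insert 1 (S \<inter> {0..1}))"
  define xs where "xs = sorted_list_of_set T"
  define N where "N = length xs - 1"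
  have T: "finite T" "T \<subseteq> {0..1}" using assms by (auto simp: T_def)
  have set: "set xs = T" using T by (simp add: xs_def)
  have sorted: "sorted_wrt (<) xs" by (simp add: xs_def strict_sorted_list_of_set)
  then have mono: "xs ! i < xs ! j" if "i < j" "j < length xs" for i j
    using that by (simp add: sorted_wrt_nth_less)
  have len: "length xs > 0" using set by (auto simp: T_def)
  have ends: "xs ! 0 = 0" "xs ! N = 1"
  proof -
    obtain q where q: "q < length xs" "xs ! q = 0" using set by (metis T_def in_set_conv_nth insertI1)
    have "xs ! 0 \<in> {0..1}" using set T len nth_mem by blast
    then show "xs ! 0 = 0" using mono[of 0 q] q by (cases "q = 0") auto
    obtain p where p: "p < length xs" "xs ! p = 1" using set by (metis T_def in_set_conv_nth insertCI)
    have "xs ! N \<in> {0..1}" using set T len nth_mem unfolding N_def by (metis diff_less subsetD zero_less_one)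
    moreover have "p = N \<or> p < N \<and> N < length xs" using p by (auto simp: N_def)
    ultimately show "xs ! N = 1" using mono[of p N] p by auto
  qed
  show thesis
  proof
    show "partition N ((!) xs)"
      unfolding partition_def using ends mono by (auto simp: N_def)
    show "S \<inter> {xs ! r<..<xs ! Suc r} = {}" if r: "r < N" for r
    proof (rule ccontr)
      assume "S \<inter> {xs ! r<..<xs ! Suc r} \<noteq> {}"
      then obtain x where x: "x \<in> S" "xs ! r < x" "x < xs ! Suc r" by auto
      have "xs ! r \<in> {0..1}" "xs ! Suc r \<in> {0..1}"
        using T(2) r nth_mem[of r xs] nth_mem[of "Suc r" xs] unfolding N_def set by (auto simp: subset_iff)
      then have "x \<in> T" using x by (auto simp: T_def)
      then obtain q where q: "q < length xs" "xs ! q = x" using set by (metis in_set_conv_nth)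
      have "r < length xs" using r by (simp add: N_def)
      moreover have "q < r \<or> q = r \<or> q = Suc r \<or> Suc r < q" by auto
      ultimately show False
        using mono[of q r] mono[of "Suc r" q] q x by auto
    qed
  qed
qed

lemma delay_partition_iff:
  "(\<exists>S. finite S \<and> (\<forall>\<omega>\<in>X. delay S (f \<omega>))) \<longleftrightarrow>
   (\<exists>N s. partition N s \<and> (\<forall>r<N. \<forall>\<omega>\<in>X. \<forall>v1\<in>controls. \<forall>v2\<in>controls.
      agree (s r) v1 v2 \<longrightarrow> agree (s (Suc r)) (f \<omega> v1) (f \<omega> v2)))" (is "?L \<longleftrightarrow> ?R")
proof
  assume ?L
  then obtain S where S: "finite S" "\<And>\<omega>. \<omega> \<in> X \<Longrightarrow> delay S (f \<omega>)" by auto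
  obtain N s where p: "partition N s" "\<And>r. r < N \<Longrightarrow> S \<inter> {s r<..<s (Suc r)} = {}"
    using partition_exists[OF S(1)] by blast
  have "agree (s (Suc r)) (f \<omega> v1) (f \<omega> v2)"
    if "r < N" "\<omega> \<in> X" "v1 \<in> controls" "v2 \<in> controls" "agree (s r) v1 v2" for r \<omega> v1 v2
    using delayD[OF S(2) that(3,4,5), of \<omega> "s (Suc r)"] that p
      partition_bounds[OF p(1), of r] partition_bounds[OF p(1), of "Suc r"] partition_le[OF p(1), of r "Suc r"]
    by simp
  then show ?R using p(1) by blast
next
  assume ?R
  then obtain N s where p: "partition N s" and
    d: "\<And>r \<omega> v1 v2. r < N \<Longrightarrow> \<omega> \<in> X \<Longrightarrow> v1 \<in> controls \<Longrightarrow> v2 \<in> controls \<Longrightarrow>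
      agree (s r) v1 v2 \<Longrightarrow> agree (s (Suc r)) (f \<omega> v1) (f \<omega> v2)" by blast
  have "delay (s ` {..N}) (f \<omega>)" if \<omega>: "\<omega> \<in> X" for \<omega>
    unfolding delay_def
  proof (intro ballI allI impI)
    fix v1 v2 :: "'b control" and t t' :: real
    assume v: "v1 \<in> controls" "v2 \<in> controls" "agree t v1 v2"
      and t: "0 \<le> t" "t \<le> t'" "t' \<le> 1" "s ` {..N} \<inter> {t<..<t'} = {}"
    have N: "N > 0" using p by (cases N) (auto simp: partition_def)
    \<comment> \<open>Last partition point not after \<open>t\<close>. The bound
      \<open>r < N\<close> keeps the interval from \<open>r\<close> to \<open>Suc r\<close> inside
      the partition even for \<open>t = 1\<close>.\<close>
    define r where "r = Max {r. r < N \<and> s r \<le> t}"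
    have "0 \<in> {r. r < N \<and> s r \<le> t}" using p t N by (auto simp: partition_def)
    moreover have "finite {r. r < N \<and> s r \<le> t}" by simp
    ultimately have "r \<in> {r. r < N \<and> s r \<le> t}" unfolding r_def using Max_in by blast
    then have r: "r < N" "s r \<le> t" by auto
    have "t' \<le> s (Suc r)"
    proof (cases "Suc r = N")
      case True
      then show ?thesis using p t by (auto simp: partition_def)
    next
      case False
      have "\<not> s (Suc r) \<le> t"
      proof
        assume "s (Suc r) \<le> t"
        then have "Suc r \<le> r" unfolding r_def using False r by (intro Max_ge) (auto simp: r_def[symmetric])
        then show False by simp
      qed
      moreover have "s (Suc r) \<in> s ` {..N}" using r by auto
      then have "s (Suc r) \<notin> {t<..<t'}" using t(4) by blast
      ultimately show ?thesis by auto
    qed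
    moreover have "agree (s (Suc r)) (f \<omega> v1) (f \<omega> v2)"
      using d[OF r(1) \<omega> v(1,2)] agree_mono[OF v(3) r(2)] by blast
    ultimately show "agree t' (f \<omega> v1) (f \<omega> v2)" by (rule agree_mono[rotated])
  qed
  then show ?L by (intro exI[of _ "s ` {..N}"]) auto
qed

lemma random_strategies_iff:
  "(m, \<alpha>) \<in> random_strategies \<longleftrightarrow> 1 \<le> m \<and> \<alpha> \<in> measurable (cube m \<Otimes>\<^sub>M control_borel) control_borel \<and>
     (\<exists>S. finite S \<and> (\<forall>\<omega>\<in>space (cube m). delay S (\<lambda>v. \<alpha> (\<omega>, v))))"
proof -
  have eq: "(\<forall>r<N. \<forall>\<omega>\<in>space (cube m). \<forall>v1\<in>controls. \<forall>v2\<in>controls.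
          (AE t in lebesgue_on {s 0..s r}. v1 t = v2 t) \<longrightarrow>
          (AE t in lebesgue_on {s 0..s (Suc r)}. \<alpha> (\<omega>, v1) t = \<alpha> (\<omega>, v2) t)) \<longleftrightarrow>
      (\<forall>r<N. \<forall>\<omega>\<in>space (cube m). \<forall>v1\<in>controls. \<forall>v2\<in>controls.
          agree (s r) v1 v2 \<longrightarrow> agree (s (Suc r)) (\<alpha> (\<omega>, v1)) (\<alpha> (\<omega>, v2)))"
    if "s 0 = 0" for N and s :: "nat \<Rightarrow> real"
    unfolding that agree_iff ..
  show ?thesis
    unfolding random_strategies_def delay_partition_iff partition_def mem_Collect_eq case_prod_conv conj_assoc
    using eq by (intro conj_cong ex_cong1 refl)
qed

section \<open>Deterministic strategies and the play they induce\<close>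

definition pure_strategies :: "('n::finite control \<Rightarrow> 'm::finite control) set" where
  "pure_strategies = {a. a \<in> measurable control_borel control_borel \<and> (\<exists>S. finite S \<and> delay S a)}"

lemma pure_in_controls: "a \<in> pure_strategies \<Longrightarrow> u \<in> controls \<Longrightarrow> a u \<in> controls"
  by (auto simp: pure_strategies_def dest: measurable_space)

lemma pure_image: "a \<in> pure_strategies \<Longrightarrow> a ` controls \<subseteq> controls"
  using pure_in_controls by blast

lemma pure_agree:
  "a \<in> pure_strategies \<Longrightarrow> v1 \<in> controls \<Longrightarrow> v2 \<in> controls \<Longrightarrow> agree 1 v1 v2 \<Longrightarrow> agree 1 (a v1) (a v2)"
  by (auto simp: pure_strategies_def intro: delay_agree)

text \<open>Deterministic strategies arise from random ones by fixing the random outcome; this is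
  how statements about them are carried over to random opponents.\<close>

lemma pure_section:
  assumes "(m, \<alpha>) \<in> random_strategies" "\<omega> \<in> space (cube m)"
  shows "(\<lambda>v. \<alpha> (\<omega>, v)) \<in> pure_strategies"
  using assms by (auto simp: random_strategies_iff pure_strategies_def intro: measurable_Pair2)

lemma random_of_pure:
  assumes "a \<in> pure_strategies"
  shows "(1, \<lambda>(\<omega>, v). a v) \<in> random_strategies"
  using assms unfolding random_strategies_iff
  by (auto simp: pure_strategies_def case_prod_beta intro: measurable_compose[OF measurable_snd])

definition induces where
  "induces a c u v \<longleftrightarrow> u \<in> controls \<and> v \<in> controls \<and> agree 1 (a v) u \<and> agree 1 (c u) v"

text \<open>Every application of the composed map extends agreement by one partition interval,
  whatever the starting controls; after \<open>N\<close> rounds the starting point is forgotten on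
  all of [0,1].\<close>

lemma iterates_agree:
  fixes a :: "'j::finite control \<Rightarrow> 'i::finite control" and c :: "'i control \<Rightarrow> 'j control"
  assumes a: "a ` controls \<subseteq> controls" "delay S a" and c: "c ` controls \<subseteq> controls" "delay S c"
    and p: "partition N s" "\<And>r. r < N \<Longrightarrow> S \<inter> {s r<..<s (Suc r)} = {}"
    and v: "v \<in> controls" "v' \<in> controls"
  shows "r \<le> N \<Longrightarrow> agree (s r) (((\<lambda>v. c (a v)) ^^ r) v) (((\<lambda>v. c (a v)) ^^ r) v')"
proof (induction r)
  case 0
  then show ?case using p(1) by (simp add: partition_def agree_0)
next
  case (Suc r)
  have in_c: "((\<lambda>v. c (a v)) ^^ n) w \<in> controls" if "w \<in> controls" for n w
    using that a(1) c(1) by (induction n) auto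
  let ?v = "((\<lambda>v. c (a v)) ^^ r) v" and ?v' = "((\<lambda>v. c (a v)) ^^ r) v'"
  have s: "0 \<le> s r" "s r \<le> s (Suc r)" "s (Suc r) \<le> 1"
    using partition_bounds[OF p(1), of r] partition_bounds[OF p(1), of "Suc r"] partition_le[OF p(1), of r "Suc r"] Suc.prems
    by auto
  have "agree (s (Suc r)) (a ?v) (a ?v')"
    using Suc s p(2)[of r] v by (intro delayD[OF a(2) _ _ _ s]) (auto intro: in_c)
  \<comment> \<open>The gain of one interval comes from the delay of \<open>a\<close>; here
    \<open>c\<close> only has to preserve it, with both times equal.\<close>
  then have "agree (s (Suc r)) (c (a ?v)) (c (a ?v'))"
    using in_c v a(1) s by (intro delayD[OF c(2), where t="s (Suc r)"]) auto
  then show ?case by simp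
qed

lemma common_delay:
  assumes "a \<in> pure_strategies" "c \<in> pure_strategies"
  obtains S where "finite S" "delay S a" "delay S c"
proof -
  obtain S T where "finite S" "delay S a" "finite T" "delay T c"
    using assms by (auto simp: pure_strategies_def)
  then show thesis by (intro that[of "S \<union> T"]) (auto intro: delay_mono)
qed

text \<open>Starting the \<open>N\<close> iterations from \<open>v\<close> or from
  \<open>c (a v)\<close> gives a.e. the same result. As the second start yields the iterate number
  \<open>N + 1\<close> of the first, the iterate number \<open>N\<close> is a fixed point.\<close>

lemma iterates_induce:
  fixes a :: "'j::finite control \<Rightarrow> 'i::finite control" and c :: "'i control \<Rightarrow> 'j control"
  assumes a: "a ` controls \<subseteq> controls" "delay S a" and c: "c ` controls \<subseteq> controls" "delay S c"
    and p: "partition N s" "\<And>r. r < N \<Longrightarrow> S \<inter> {s r<..<s (Suc r)} = {}"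
    and v: "v \<in> controls"
  shows "induces a c (a (((\<lambda>v. c (a v)) ^^ N) v)) (((\<lambda>v. c (a v)) ^^ N) v)"
proof -
  have in_c: "((\<lambda>v. c (a v)) ^^ n) w \<in> controls" if "w \<in> controls" for n w
    using that a(1) c(1) by (induction n) auto
  have cv: "c (a v) \<in> controls" using a c v by auto
  have "agree 1 (((\<lambda>v. c (a v)) ^^ N) (c (a v))) (((\<lambda>v. c (a v)) ^^ N) v)"
    using iterates_agree[OF a c p cv v, of N] p(1) by (simp add: partition_def)
  moreover have "((\<lambda>v. c (a v)) ^^ N) (c (a v)) = c (a (((\<lambda>v. c (a v)) ^^ N) v))"
    by (metis funpow_swap1)
  ultimately show ?thesis using in_c[OF v] a by (auto simp: induces_def)
qed

lemma induces_exists: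
  fixes a :: "'j::finite control \<Rightarrow> 'i::finite control"
  assumes "a \<in> pure_strategies" "c \<in> pure_strategies"
  shows "\<exists>u v. induces a c u v"
proof -
  obtain S where S: "finite S" "delay S a" "delay S c" using common_delay[OF assms] .
  obtain N s where p: "partition N s" "\<And>r. r < N \<Longrightarrow> S \<inter> {s r<..<s (Suc r)} = {}"
    using partition_exists[OF S(1)] by blast
  obtain b :: "real^'j" where "b \<in> prob_simplex" using prob_simplex_nonempty by blast
  then have "(\<lambda>s\<in>{0..1}. b) \<in> controls" by (rule const_in_controls)
  from iterates_induce[OF pure_image[OF assms(1)] S(2) pure_image[OF assms(2)] S(3) p this]
  show ?thesis by blast
qed

text \<open>The second control of an induced pair is a.e. fixed by the composed map and hence by all
  its iterates, while \<open>N\<close> iterations make any two starting points agree.\<close>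

lemma induces_unique:
  assumes ac: "a \<in> pure_strategies" "c \<in> pure_strategies" and uv: "induces a c u v" "induces a c u' v'"
  shows "agree 1 u u' \<and> agree 1 v v'"
proof -
  obtain S where S: "finite S" "delay S a" "delay S c" using common_delay[OF ac] .
  obtain N s where p: "partition N s" "\<And>r. r < N \<Longrightarrow> S \<inter> {s r<..<s (Suc r)} = {}"
    using partition_exists[OF S(1)] by blast
  have cav: "agree 1 (c (a v)) v" if "induces a c u v" for u v
  proof -
    have "agree 1 (c (a v)) (c u)"
      using that by (intro pure_agree[OF ac(2)] pure_in_controls[OF ac(1)]) (auto simp: induces_def)
    then show ?thesis using that unfolding induces_def by (blast intro: agree_trans)
  qed
  have it: "agree 1 (((\<lambda>v. c (a v)) ^^ n) v) v" if "induces a c u v" for u v n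
  proof (induction n)
    case (Suc n)
    have v: "v \<in> controls" using that by (auto simp: induces_def)
    then have vn: "((\<lambda>v. c (a v)) ^^ n) v \<in> controls"
      by (induction n) (simp_all add: pure_in_controls[OF ac(1)] pure_in_controls[OF ac(2)])
    have "agree 1 (a (((\<lambda>v. c (a v)) ^^ n) v)) (a v)" by (rule pure_agree[OF ac(1) vn v Suc])
    then have "agree 1 (c (a (((\<lambda>v. c (a v)) ^^ n) v))) (c (a v))"
      by (intro pure_agree[OF ac(2)] pure_in_controls[OF ac(1)] vn v)
    then have "agree 1 (c (a (((\<lambda>v. c (a v)) ^^ n) v))) v" using cav[OF that] by (rule agree_trans)
    then show ?case by simp
  qed simp
  have v: "v \<in> controls" "v' \<in> controls" using uv by (auto simp: induces_def)
  have "agree 1 (((\<lambda>v. c (a v)) ^^ N) v) (((\<lambda>v. c (a v)) ^^ N) v')"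
    using iterates_agree[OF pure_image[OF ac(1)] S(2) pure_image[OF ac(2)] S(3) p v, of N] p(1)
    by (simp add: partition_def)
  then have vv: "agree 1 v v'"
    by (rule agree_trans[OF agree_trans[OF agree_sym[OF it[OF uv(1)]]] it[OF uv(2)]])
  have "agree 1 (a v) (a v')" by (rule pure_agree[OF ac(1) v vv])
  moreover have "agree 1 (a v) u" "agree 1 (a v') u'" using uv by (auto simp: induces_def)
  ultimately have "agree 1 u u'" using agree_trans[OF agree_trans[OF agree_sym]] by blast
  with vv show ?thesis by blast
qed

text \<open>The choice is the one made in \<open>induced\<close>, so that \<open>payoff_conv\<close>
  is a mere unfolding; by \<open>pure_payoff_eq\<close> any induced pair gives the same
  number.\<close>

definition pure_payoff where
  "pure_payoff M a c = (let (u, v) = (SOME (u, v). induces a c u v) in running_payoff M u v)"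

lemma pure_payoff_eq:
  assumes "a \<in> pure_strategies" "c \<in> pure_strategies" "induces a c u v"
  shows "pure_payoff M a c = running_payoff M u v"
proof -
  define p where "p = (SOME (u, v). induces a c u v)"
  have "induces a c (fst p) (snd p)"
    unfolding p_def by (rule someI2[of _ "(u, v)"]) (use assms in auto)
  with induces_unique[OF assms(1,2) this assms(3)] assms(3)
  have "running_payoff M (fst p) (snd p) = running_payoff M u v"
    by (intro running_payoff_cong) (auto simp: induces_def)
  then show ?thesis unfolding pure_payoff_def p_def[symmetric] by (simp add: case_prod_beta)
qed

lemma pure_payoff_bound:
  assumes "a \<in> pure_strategies" "c \<in> pure_strategies"
  shows "\<bar>pure_payoff M a c\<bar> \<le> entry_bound M"
proof -
  obtain u v where "induces a c u v" using induces_exists[OF assms] by blast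
  then show ?thesis using running_payoff_bound[of u v M] by (auto simp: pure_payoff_eq[OF assms] induces_def)
qed

lemma payoff_conv:
  "payoff G \<pi> \<alpha> \<beta> = (\<Sum>k\<in>UNIV. \<Sum>l\<in>UNIV. \<pi> $ (k, l) *
     (LINT \<omega>|(cube (fst (\<alpha> k)) \<Otimes>\<^sub>M cube (fst (\<beta> l))).
        pure_payoff (G k l) (\<lambda>v. snd (\<alpha> k) (fst \<omega>, v)) (\<lambda>u. snd (\<beta> l) (snd \<omega>, u))))"
  unfolding payoff_def induced_def pure_payoff_def induces_def agree_iff running_payoff_def
  by (simp add: case_prod_beta)

lemma prob_space_cube: "prob_space (cube m)"
proof -
  have "prob_space (restrict_space lborel {0..1::real})"
    by (rule prob_spaceI) (simp add: emeasure_restrict_space)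
  then show ?thesis unfolding cube_def by (intro prob_space_PiM)
qed

text \<open>The chosen pair carries no measurability. Since the delay sets do not depend on the
  random outcome, one number \<open>N\<close> of iterations from a fixed constant control yields an
  induced pair for all outcomes, and these iterates are measurable in the outcome by
  induction.\<close>

lemma pure_payoff_measurable:
  fixes \<alpha> :: "(nat \<Rightarrow> real) \<times> 'j::finite control \<Rightarrow> 'i::finite control"
  assumes \<alpha>: "(m, \<alpha>) \<in> random_strategies" and \<beta>: "(n, \<beta>) \<in> random_strategies"
  shows "(\<lambda>\<omega>. pure_payoff M (\<lambda>v. \<alpha> (fst \<omega>, v)) (\<lambda>u. \<beta> (snd \<omega>, u))) \<in> borel_measurable (cube m \<Otimes>\<^sub>M cube n)"
proof -
  have [measurable]: "\<alpha> \<in> measurable (cube m \<Otimes>\<^sub>M control_borel) control_borel"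
    "\<beta> \<in> measurable (cube n \<Otimes>\<^sub>M control_borel) control_borel"
    using assms by (auto simp: random_strategies_iff)
  obtain S1 S2 where S12: "finite S1" "finite S2" "\<And>\<omega>. \<omega> \<in> space (cube m) \<Longrightarrow> delay S1 (\<lambda>v. \<alpha> (\<omega>, v))"
    "\<And>\<omega>. \<omega> \<in> space (cube n) \<Longrightarrow> delay S2 (\<lambda>v. \<beta> (\<omega>, v))"
    using assms unfolding random_strategies_iff by blast
  define S where "S = S1 \<union> S2"
  have S: "finite S" "\<And>\<omega>. \<omega> \<in> space (cube m) \<Longrightarrow> delay S (\<lambda>v. \<alpha> (\<omega>, v))"
    "\<And>\<omega>. \<omega> \<in> space (cube n) \<Longrightarrow> delay S (\<lambda>v. \<beta> (\<omega>, v))"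
    using S12 by (auto simp: S_def intro: delay_mono)
  obtain N s where p: "partition N s" "\<And>r. r < N \<Longrightarrow> S \<inter> {s r<..<s (Suc r)} = {}"
    using partition_exists[OF S(1)] by blast
  obtain b :: "real^'j" where "b \<in> prob_simplex" using prob_simplex_nonempty by blast
  define v0 where "v0 = (\<lambda>s\<in>{0..1::real}. b)"
  have v0: "v0 \<in> controls" unfolding v0_def by (rule const_in_controls) fact
  define V where "V = (\<lambda>r \<omega>. ((\<lambda>v. \<beta> (snd \<omega>, \<alpha> (fst \<omega>, v))) ^^ r) v0)"
  have V[measurable]: "V r \<in> measurable (cube m \<Otimes>\<^sub>M cube n) control_borel" for r
  proof (induction r)
    case 0
    then show ?case using v0 by (simp add: V_def)
  next
    case (Suc r)
    have [measurable]: "V r \<in> measurable (cube m \<Otimes>\<^sub>M cube n) control_borel" by fact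
    have "(\<lambda>\<omega>. \<beta> (snd \<omega>, \<alpha> (fst \<omega>, V r \<omega>))) \<in> measurable (cube m \<Otimes>\<^sub>M cube n) control_borel"
      by measurable
    then show ?case by (simp add: V_def)
  qed
  have eq: "pure_payoff M (\<lambda>v. \<alpha> (fst \<omega>, v)) (\<lambda>u. \<beta> (snd \<omega>, u)) =
      (\<lambda>(u, v). running_payoff M u v) (\<alpha> (fst \<omega>, V N \<omega>), V N \<omega>)"
    if "\<omega> \<in> space (cube m \<Otimes>\<^sub>M cube n)" for \<omega>
  proof -
    have \<omega>: "fst \<omega> \<in> space (cube m)" "snd \<omega> \<in> space (cube n)" using that by (auto simp: space_pair_measure)
    note pures = pure_section[OF \<alpha> \<omega>(1)] pure_section[OF \<beta> \<omega>(2)]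
    have "induces (\<lambda>v. \<alpha> (fst \<omega>, v)) (\<lambda>u. \<beta> (snd \<omega>, u)) (\<alpha> (fst \<omega>, V N \<omega>)) (V N \<omega>)"
      using iterates_induce[OF pure_image[OF pures(1)] S(2)[OF \<omega>(1)] pure_image[OF pures(2)] S(3)[OF \<omega>(2)] p v0]
      unfolding V_def .
    from pure_payoff_eq[OF pures this] show ?thesis by simp
  qed
  have "(\<lambda>\<omega>. (\<lambda>(u, v). running_payoff M u v) (\<alpha> (fst \<omega>, V N \<omega>), V N \<omega>)) \<in> borel_measurable (cube m \<Otimes>\<^sub>M cube n)"
    by (rule measurable_compose[OF _ running_payoff_measurable]) measurable
  then show ?thesis by (subst measurable_cong[OF eq])
qed

subsection \<open>Random strategies against pure ones\<close>

definition expected_payoff ::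
  "real ^ 'j::finite ^ 'i::finite \<Rightarrow> ('j control \<Rightarrow> 'i control) \<Rightarrow> ('j, 'i) strategy \<Rightarrow> real" where
  "expected_payoff M a \<beta> = (LINT \<omega>|cube (fst \<beta>). pure_payoff M a (\<lambda>u. snd \<beta> (\<omega>, u)))"

lemma space_cube_nonempty: "space (cube m) \<noteq> {}"
  by (rule prob_space.not_empty[OF prob_space_cube])

lemma pure_payoff_section_measurable:
  assumes a: "a \<in> pure_strategies" and \<beta>: "(n, \<beta>) \<in> random_strategies"
  shows "(\<lambda>\<omega>. pure_payoff M a (\<lambda>u. \<beta> (\<omega>, u))) \<in> borel_measurable (cube n)"
proof -
  obtain \<omega>1 where "\<omega>1 \<in> space (cube 1)" using space_cube_nonempty by blast
  from measurable_Pair2[OF pure_payoff_measurable[OF random_of_pure[OF a] \<beta>] this] show ?thesis by simp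
qed

lemma expected_payoff_bound:
  assumes a: "a \<in> pure_strategies" and \<beta>: "\<beta> \<in> random_strategies"
  shows "\<bar>expected_payoff M a \<beta>\<bar> \<le> entry_bound M"
proof -
  obtain n f where nf: "\<beta> = (n, f)" by (cases \<beta>)
  interpret prob_space "cube n" by (rule prob_space_cube)
  have bd: "\<bar>pure_payoff M a (\<lambda>u. f (\<omega>, u))\<bar> \<le> entry_bound M" if "\<omega> \<in> space (cube n)" for \<omega>
    using \<beta> nf that by (intro pure_payoff_bound a pure_section[of n]) auto
  have int: "integrable (cube n) (\<lambda>\<omega>. pure_payoff M a (\<lambda>u. f (\<omega>, u)))"
    by (rule integrable_const_bound[where B="entry_bound M"])
       (use bd \<beta> nf in \<open>auto intro: pure_payoff_section_measurable[OF a]\<close>)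
  have "(LINT \<omega>|cube n. pure_payoff M a (\<lambda>u. f (\<omega>, u))) \<le> entry_bound M"
    by (rule integral_le_const[OF int]) (use bd in \<open>auto intro!: AE_I2 simp: abs_le_iff\<close>)
  moreover have "- entry_bound M \<le> (LINT \<omega>|cube n. pure_payoff M a (\<lambda>u. f (\<omega>, u)))"
    by (rule integral_ge_const[OF int]) (use bd in \<open>force intro!: AE_I2 simp: abs_le_iff\<close>)
  ultimately show ?thesis by (auto simp: expected_payoff_def nf abs_le_iff)
qed

text \<open>The randomness of player 2 is integrated first, with the outcome of player 1 fixed. A
  bound that holds against every deterministic strategy then passes to random ones.\<close>

lemma expected_payoff_Fubini:
  assumes \<alpha>: "(m, \<alpha>) \<in> random_strategies" and \<beta>: "(n, \<beta>) \<in> random_strategies"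
  shows "integrable (cube m) (\<lambda>\<omega>. expected_payoff M (\<lambda>v. \<alpha> (\<omega>, v)) (n, \<beta>))"
    and "(LINT \<omega>|(cube m \<Otimes>\<^sub>M cube n). pure_payoff M (\<lambda>v. \<alpha> (fst \<omega>, v)) (\<lambda>u. \<beta> (snd \<omega>, u))) =
      (LINT \<omega>|cube m. expected_payoff M (\<lambda>v. \<alpha> (\<omega>, v)) (n, \<beta>))"
proof -
  interpret m: prob_space "cube m" by (rule prob_space_cube)
  interpret n: prob_space "cube n" by (rule prob_space_cube)
  interpret mn: pair_prob_space "cube m" "cube n" ..
  have "\<bar>pure_payoff M (\<lambda>v. \<alpha> (fst \<omega>, v)) (\<lambda>u. \<beta> (snd \<omega>, u))\<bar> \<le> entry_bound M"
    if "\<omega> \<in> space (cube m \<Otimes>\<^sub>M cube n)" for \<omega>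
    using that by (intro pure_payoff_bound pure_section[OF \<alpha>] pure_section[OF \<beta>]) (auto simp: space_pair_measure)
  then have int: "integrable (cube m \<Otimes>\<^sub>M cube n) (\<lambda>\<omega>. pure_payoff M (\<lambda>v. \<alpha> (fst \<omega>, v)) (\<lambda>u. \<beta> (snd \<omega>, u)))"
    by (intro mn.integrable_const_bound[where B="entry_bound M"] AE_I2 pure_payoff_measurable[OF \<alpha> \<beta>]) simp
  show "integrable (cube m) (\<lambda>\<omega>. expected_payoff M (\<lambda>v. \<alpha> (\<omega>, v)) (n, \<beta>))"
    using mn.integrable_fst'[OF int] by (simp add: expected_payoff_def)
  show "(LINT \<omega>|(cube m \<Otimes>\<^sub>M cube n). pure_payoff M (\<lambda>v. \<alpha> (fst \<omega>, v)) (\<lambda>u. \<beta> (snd \<omega>, u))) =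
      (LINT \<omega>|cube m. expected_payoff M (\<lambda>v. \<alpha> (\<omega>, v)) (n, \<beta>))"
    using mn.integral_fst'[OF int] by (simp add: expected_payoff_def)
qed

section \<open>Cubes of different dimensions, and mixing by a coin\<close>

abbreviation U01 :: "real measure" where "U01 \<equiv> restrict_space lborel {0..1}"

lemma prob_space_U01: "prob_space U01"
  by (rule prob_spaceI) (simp add: emeasure_restrict_space)

lemma product_prob_space_U01: "product_prob_space (\<lambda>_. U01)"
proof -
  show ?thesis
    using prob_space_U01 by (intro product_prob_space.intro product_sigma_finite.intro product_prob_space_axioms.intro)
       (auto intro: prob_space_imp_sigma_finite)
qed

lemma cube_restrict_measurable:
  "m \<le> n \<Longrightarrow> (\<lambda>\<omega>. restrict \<omega> {..<m}) \<in> measurable (cube n) (cube m)"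
  unfolding cube_def by (rule measurable_restrict_subset) auto

text \<open>The small cube is the image of the large one under forgetting coordinates. Strategies
  built on cubes of different dimensions can thus be moved to a common one without changing expected
  payoffs.\<close>

lemma cube_restrict_integral:
  fixes F :: "(nat \<Rightarrow> real) \<Rightarrow> real"
  assumes "m \<le> n" "F \<in> borel_measurable (cube m)"
  shows "(LINT \<omega>|cube n. F (restrict \<omega> {..<m})) = (LINT \<omega>|cube m. F \<omega>)"
proof -
  interpret product_prob_space "\<lambda>_::nat. U01" by (rule product_prob_space_U01)
  have "cube m = distr (cube n) (cube m) (\<lambda>\<omega>. restrict \<omega> {..<m})"
    unfolding cube_def using assms(1) by (intro distr_restrict) auto
  then have "(LINT \<omega>|cube m. F \<omega>) = (LINT \<omega>|distr (cube n) (cube m) (\<lambda>\<omega>. restrict \<omega> {..<m}). F \<omega>)" by simp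
  also have "\<dots> = (LINT \<omega>|cube n. F (restrict \<omega> {..<m}))"
    by (rule integral_distr[OF cube_restrict_measurable[OF assms(1)] assms(2)])
  finally show ?thesis by simp
qed

lemma strategy_on_larger_cube:
  assumes "(m, \<beta>) \<in> random_strategies" "m \<le> n"
  shows "(\<lambda>(\<omega>, u). \<beta> (restrict \<omega> {..<m}, u)) \<in> measurable (cube n \<Otimes>\<^sub>M control_borel) control_borel"
    and "\<exists>S. finite S \<and> (\<forall>\<omega>\<in>space (cube n). delay S (\<lambda>u. \<beta> (restrict \<omega> {..<m}, u)))"
proof -
  have [measurable]: "\<beta> \<in> measurable (cube m \<Otimes>\<^sub>M control_borel) control_borel"
    using assms by (auto simp: random_strategies_iff)
  note [measurable] = cube_restrict_measurable[OF assms(2)]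
  show "(\<lambda>(\<omega>, u). \<beta> (restrict \<omega> {..<m}, u)) \<in> measurable (cube n \<Otimes>\<^sub>M control_borel) control_borel"
    by measurable
  show "\<exists>S. finite S \<and> (\<forall>\<omega>\<in>space (cube n). delay S (\<lambda>u. \<beta> (restrict \<omega> {..<m}, u)))"
    using assms(1) measurable_space[OF cube_restrict_measurable[OF assms(2)]]
    by (auto simp: random_strategies_iff)
qed

lemma integral_coin:
  fixes x y :: real
  assumes "0 \<le> r" "r \<le> 1"
  shows "(LINT s|U01. (if s < r then x else y)) = r * x + (1 - r) * y"
proof -
  interpret prob_space U01 by (rule prob_space_U01)
  have "(LINT s|U01. (if s < r then x else y)) = (LINT s|U01. (x - y) * indicator {s. s < r} s + y)"
    by (rule Bochner_Integration.integral_cong) auto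
  also have "\<dots> = (x - y) * (LINT s|U01. indicator {s. s < r} s) + y"
  proof -
    have "integrable U01 (\<lambda>s. indicator {s. s < r} s :: real)"
      by (rule integrable_const_bound[where B=1]) (auto simp: measurable_restrict_space1)
    then show ?thesis using prob_space
      by (simp add: space_restrict_space del: Bochner_Integration.integral_indicator)
  qed
  also have "(LINT s|U01. indicator {s. s < r} s) = measure U01 ({s. s < r} \<inter> {0..1})"
    by (simp add: space_restrict_space)
  also have "\<dots> = measure lborel ({s. s < r} \<inter> {0..1})"
    by (rule measure_restrict_space) auto
  also have "{s. s < r} \<inter> {0..1} = {0..<r}" using assms by auto
  finally show ?thesis using assms by (simp add: algebra_simps)
qed

text \<open>The last coordinate of the cube serves as the coin.\<close>

lemma mixed_strategy:
  fixes \<beta>1 \<beta>2 :: "('j::finite, 'i::finite) strategy"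
  assumes \<beta>1: "\<beta>1 \<in> random_strategies" and \<beta>2: "\<beta>2 \<in> random_strategies" and r: "0 \<le> r" "r \<le> 1"
  shows "\<exists>\<beta>\<in>random_strategies. \<forall>M. \<forall>a\<in>pure_strategies.
    expected_payoff M a \<beta> = r * expected_payoff M a \<beta>1 + (1 - r) * expected_payoff M a \<beta>2"
proof -
  obtain m1 f1 m2 f2 where e: "\<beta>1 = (m1, f1)" "\<beta>2 = (m2, f2)" by (cases \<beta>1, cases \<beta>2)
  \<comment> \<open>Both strategies read only coordinates below \<open>n\<close>, so coordinate
    \<open>n\<close> of the cube of dimension \<open>Suc n\<close> is independent of what they
    use.\<close>
  define n where "n = max m1 m2"
  have n: "m1 \<le> n" "m2 \<le> n" "m1 \<le> Suc n" "m2 \<le> Suc n" by (auto simp: n_def)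
  define f where "f = (\<lambda>(\<omega>, u). if \<omega> n < r then f1 (restrict \<omega> {..<m1}, u) else f2 (restrict \<omega> {..<m2}, u))"
  interpret product_prob_space "\<lambda>_::nat. U01" by (rule product_prob_space_U01)
  have coin[measurable]: "(\<lambda>\<omega>. \<omega> n) \<in> borel_measurable (cube (Suc n))"
    unfolding cube_def
    by (rule measurable_compose[OF measurable_component_singleton[of n]])
       (auto intro: measurable_restrict_space1)
  note s1 = strategy_on_larger_cube[OF \<beta>1[unfolded e] n(3)] and s2 = strategy_on_larger_cube[OF \<beta>2[unfolded e] n(4)]
  note [measurable] = s1(1) s2(1)
  have "f \<in> measurable (cube (Suc n) \<Otimes>\<^sub>M control_borel) control_borel"
  proof -
    have "f = (\<lambda>x. if fst x n < r then (\<lambda>(\<omega>, u). f1 (restrict \<omega> {..<m1}, u)) x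
        else (\<lambda>(\<omega>, u). f2 (restrict \<omega> {..<m2}, u)) x)"
      by (auto simp: f_def)
    also have "\<dots> \<in> measurable (cube (Suc n) \<Otimes>\<^sub>M control_borel) control_borel"
      by (intro measurable_If s1(1) s2(1)) measurable
    finally show ?thesis .
  qed
  moreover have "\<exists>S. finite S \<and> (\<forall>\<omega>\<in>space (cube (Suc n)). delay S (\<lambda>u. f (\<omega>, u)))"
  proof -
    obtain S1 S2 where "finite S1" "finite S2"
      "\<forall>\<omega>\<in>space (cube (Suc n)). delay S1 (\<lambda>u. f1 (restrict \<omega> {..<m1}, u))"
      "\<forall>\<omega>\<in>space (cube (Suc n)). delay S2 (\<lambda>u. f2 (restrict \<omega> {..<m2}, u))"
      using s1(2) s2(2) by blast
    then have "delay (S1 \<union> S2) (\<lambda>u. f (\<omega>, u))" if "\<omega> \<in> space (cube (Suc n))" for \<omega>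
      using that by (cases "\<omega> n < r") (auto simp: f_def intro: delay_mono)
    with \<open>finite S1\<close> \<open>finite S2\<close> show ?thesis by (intro exI[of _ "S1 \<union> S2"]) auto
  qed
  ultimately have f: "(Suc n, f) \<in> random_strategies" by (simp add: random_strategies_iff)
  have "expected_payoff M a (Suc n, f) = r * expected_payoff M a \<beta>1 + (1 - r) * expected_payoff M a \<beta>2"
    if a: "a \<in> pure_strategies" for M a
  proof -
    define F where "F = (\<lambda>\<omega>. pure_payoff M a (\<lambda>u. f (\<omega>, u)))"
    define F1 where "F1 = (\<lambda>\<omega>. pure_payoff M a (\<lambda>u. f1 (\<omega>, u)))"
    define F2 where "F2 = (\<lambda>\<omega>. pure_payoff M a (\<lambda>u. f2 (\<omega>, u)))"
    have m: "F \<in> borel_measurable (cube (Suc n))" "F1 \<in> borel_measurable (cube m1)" "F2 \<in> borel_measurable (cube m2)"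
      unfolding F_def F1_def F2_def
      using f \<beta>1 \<beta>2 e by (auto intro: pure_payoff_section_measurable[OF a])
    have bd: "\<bar>pure_payoff M a (\<lambda>u. g (\<omega>, u))\<bar> \<le> entry_bound M"
      if "(k, g) \<in> random_strategies" "\<omega> \<in> space (cube k)" for k g \<omega>
      using that by (intro pure_payoff_bound a pure_section)
    have intF: "integrable (cube (Suc n)) F"
      using bd[OF f] by (intro finite_measure.integrable_const_bound[where B="entry_bound M"] m AE_I2
        prob_space.finite_measure prob_space_cube) (auto simp: F_def)
    have int12: "integrable (cube n) (\<lambda>\<omega>. F1 (restrict \<omega> {..<m1}))" "integrable (cube n) (\<lambda>\<omega>. F2 (restrict \<omega> {..<m2}))"
      using bd[OF \<beta>1[unfolded e]] bd[OF \<beta>2[unfolded e]] n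
        measurable_space[OF cube_restrict_measurable[of m1 n]] measurable_space[OF cube_restrict_measurable[of m2 n]]
      by (auto intro!: finite_measure.integrable_const_bound[where B="entry_bound M"] AE_I2
        measurable_compose[OF cube_restrict_measurable] m(2,3)[unfolded F1_def F2_def]
        prob_space.finite_measure prob_space_cube simp: F1_def F2_def)
    have "expected_payoff M a (Suc n, f) = (LINT \<omega>|PiM (insert n {..<n}) (\<lambda>_. U01). F \<omega>)"
      by (simp add: expected_payoff_def F_def cube_def lessThan_Suc)
    also have "\<dots> = (LINT \<omega>|PiM {..<n} (\<lambda>_. U01). LINT y|U01. F (fun_upd \<omega> n y))"
      using intF by (intro product_integral_insert) (auto simp: cube_def lessThan_Suc)
    also have "\<dots> = (LINT \<omega>|cube n. r * F1 (restrict \<omega> {..<m1}) + (1 - r) * F2 (restrict \<omega> {..<m2}))"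
    proof -
      have restr: "restrict (fun_upd \<omega> n y) {..<m} = restrict \<omega> {..<m}" if "m \<le> n" for \<omega> :: "nat \<Rightarrow> real" and y m
        using that by (auto simp: restrict_def)
      have "F (fun_upd \<omega> n y) = (if y < r then F1 (restrict \<omega> {..<m1}) else F2 (restrict \<omega> {..<m2}))" for \<omega> y
        using n by (auto simp: F_def F1_def F2_def f_def restr)
      then show ?thesis by (simp add: integral_coin[OF r] cube_def)
    qed
    also have "\<dots> = r * (LINT \<omega>|cube n. F1 (restrict \<omega> {..<m1})) + (1 - r) * (LINT \<omega>|cube n. F2 (restrict \<omega> {..<m2}))"
      using int12 by simp
    also have "\<dots> = r * expected_payoff M a \<beta>1 + (1 - r) * expected_payoff M a \<beta>2"
      unfolding cube_restrict_integral[OF n(1) m(2)] cube_restrict_integral[OF n(2) m(3)]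
      by (simp add: expected_payoff_def e F1_def F2_def)
    finally show ?thesis .
  qed
  then show ?thesis using f by blast
qed

subsection \<open>Rescaling the time interval\<close>

lemma affine_lebesgue_measurable:
  fixes c t :: real
  assumes "c \<noteq> 0"
  shows "(\<lambda>s. t + c * s) \<in> lebesgue \<rightarrow>\<^sub>M lebesgue"
  using lebesgue_affine_measurable[where c="\<lambda>_::real. c" and t=t] assms by simp

text \<open>The exceptional set need not be Borel; it is covered by a Borel null set
  \<open>N\<close> before the affine change of variable for \<open>lborel\<close> is
  applied.\<close>

lemma AE_lebesgue_affine:
  fixes c t :: real
  assumes c: "c \<noteq> 0" and P: "AE s in lebesgue. P s"
  shows "AE s in lebesgue. P (t + c * s)"
proof -
  obtain N where N: "N \<in> null_sets lborel" "{s. \<not> P s} \<subseteq> N"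
    using P unfolding AE_completion_iff by (auto simp: eventually_ae_filter)
  have "AE s in lborel. s \<notin> N" by (rule AE_not_in[OF N(1)])
  moreover have "Measurable.pred borel (\<lambda>s. s \<notin> N)" using N(1) by (auto intro!: pred_intros_logic)
  ultimately have "AE s in lborel. t + c * s \<notin> N" using AE_borel_affine[OF c] by blast
  then have "AE s in lborel. P (t + c * s)" by (rule AE_mp) (use N in \<open>auto intro!: AE_I2\<close>)
  then show ?thesis by (simp add: AE_completion_iff)
qed

section \<open>Cutting the play at a fixed time \<open>h\<close>\<close>

context
  fixes h :: real
  assumes h: "0 < h" "h < 1"
begin

definition join :: "real ^ 'n::finite \<Rightarrow> 'n control \<Rightarrow> 'n control" where
  "join b v = (\<lambda>s\<in>{0..1}. if s < h then b else v ((s - h) / (1 - h)))"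

definition shift :: "'n::finite control \<Rightarrow> 'n control" where
  "shift u = (\<lambda>s\<in>{0..1}. u (h + (1 - h) * s))"

lemma unscale_bounds: "s \<in> {h..1} \<Longrightarrow> (s - h) / (1 - h) \<in> {0..1}"
  using h by (auto simp: field_simps)

lemma scale_bounds: "s \<in> {0..1} \<Longrightarrow> h + (1 - h) * s \<in> {h..1}"
proof -
  assume s: "s \<in> {0..1}"
  have "0 \<le> (1 - h) * s" using s h by auto
  moreover have "(1 - h) * s \<le> (1 - h) * 1" using s h by (intro mult_left_mono) auto
  ultimately show ?thesis by auto
qed

lemma scale_unscale: "h + (1 - h) * ((s - h) / (1 - h)) = s"
  using h by simp

lemma unscale_eq_affine: "(s - h) / (1 - h) = - h / (1 - h) + (1 / (1 - h)) * s"
  using h by (simp add: diff_divide_distrib)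

lemma controls_affine_measurable:
  assumes "v \<in> controls" "c \<noteq> 0"
  shows "(\<lambda>s. if t + c * s \<in> {0..1} then v (t + c * s) else 0) \<in> borel_measurable L01"
proof -
  have "(\<lambda>s. if s \<in> {0..1} then v s else 0) \<in> borel_measurable lebesgue"
    using controls_measurable[OF assms(1)] by (subst borel_measurable_if) auto
  from measurable_compose[OF affine_lebesgue_measurable[OF assms(2)] this]
  show ?thesis by (intro measurable_restrict_space1)
qed

lemma join_in_controls:
  assumes "b \<in> prob_simplex" "v \<in> controls"
  shows "join b v \<in> controls"
proof -
  have "join b v \<in> borel_measurable L01"
  proof (rule measurable_cong[THEN iffD1])
    show "(\<lambda>s. if s < h then b else if - h / (1 - h) + (1 / (1 - h)) * s \<in> {0..1}
        then v (- h / (1 - h) + (1 / (1 - h)) * s) else 0) \<in> borel_measurable L01"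
    proof (rule measurable_If)
      have "{s \<in> space L01. s < h} = {0..<h}" using h by auto
      also have "\<dots> \<in> sets L01" using h by (subst sets_restrict_space_iff) auto
      finally show "{s \<in> space L01. s < h} \<in> sets L01" .
      show "(\<lambda>s. if - h / (1 - h) + (1 / (1 - h)) * s \<in> {0..1}
          then v (- h / (1 - h) + (1 / (1 - h)) * s) else 0) \<in> borel_measurable L01"
        using h by (intro controls_affine_measurable assms(2)) auto
    qed simp
    show "(if s < h then b else if - h / (1 - h) + (1 / (1 - h)) * s \<in> {0..1}
        then v (- h / (1 - h) + (1 / (1 - h)) * s) else 0) = join b v s" if "s \<in> space L01" for s
      using that unscale_bounds[of s] unfolding unscale_eq_affine[symmetric] by (auto simp: join_def)
  qed
  moreover have "join b v s \<in> prob_simplex" if "s \<in> {0..1}" for s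
    using that assms(1) controls_simplex[OF assms(2) unscale_bounds[of s]] by (auto simp: join_def)
  ultimately show ?thesis by (auto simp: controls_def join_def)
qed

lemma shift_in_controls:
  assumes "u \<in> controls"
  shows "shift u \<in> controls"
proof -
  have "shift u \<in> borel_measurable L01"
  proof (rule measurable_cong[THEN iffD1])
    show "(\<lambda>s. if h + (1 - h) * s \<in> {0..1} then u (h + (1 - h) * s) else 0) \<in> borel_measurable L01"
      using h by (intro controls_affine_measurable assms) auto
    show "(if h + (1 - h) * s \<in> {0..1} then u (h + (1 - h) * s) else 0) = shift u s" if "s \<in> space L01" for s
      using that scale_bounds[of s] h by (auto simp: shift_def)
  qed
  moreover have "shift u s \<in> prob_simplex" if "s \<in> {0..1}" for s
    using that controls_simplex[OF assms, of "h + (1 - h) * s"] scale_bounds[of s] h by (auto simp: shift_def)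
  ultimately show ?thesis by (auto simp: controls_def shift_def)
qed

lemma integral_rescaled:
  fixes g :: "real \<Rightarrow> real"
  shows "(LINT s|L01. indicator {h..1} s * g ((s - h) / (1 - h))) = (1 - h) * (LINT s|L01. g s)"
proof -
  define G where "G s = indicator {0..1} s * g s" for s
  have "(LINT s|L01. indicator {h..1} s * g ((s - h) / (1 - h))) = (LINT s|lebesgue. G (- h / (1 - h) + (1 / (1 - h)) * s))"
  proof (subst integral_restrict_space, simp, rule Bochner_Integration.integral_cong)
    fix s :: real
    have "(s - h) / (1 - h) \<in> {0..1} \<longleftrightarrow> s \<in> {h..1}" using h by (auto simp: field_simps)
    then show "indicator {0..1} s *\<^sub>R (indicator {h..1} s * g ((s - h) / (1 - h))) = G (- h / (1 - h) + 1 / (1 - h) * s)"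
      using h unfolding G_def unscale_eq_affine[symmetric] by (auto simp: indicator_def)
  qed simp
  also have "\<dots> = (1 - h) * (LINT s|lebesgue. G s)"
    using lebesgue_integral_real_affine[of "1 / (1 - h)" G "- h / (1 - h)"] h by (simp add: field_simps)
  also have "(LINT s|lebesgue. G s) = (LINT s|L01. g s)"
    by (subst integral_restrict_space) (auto simp: G_def[abs_def])
  finally show ?thesis .
qed

lemma join_measurable:
  assumes b: "b \<in> prob_simplex"
  shows "join b \<in> measurable control_borel control_borel"
proof (rule measurable_control_lipschitz[where C="1 - h"])
  show "join b u \<in> controls" if "u \<in> controls" for u by (rule join_in_controls[OF b that])
  show "L1_dist (join b u) (join b v) \<le> (1 - h) * L1_dist u v" for u v
    unfolding L1_dist_def integral_rescaled[symmetric]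
    by (rule eq_refl, rule Bochner_Integration.integral_cong) (auto simp: join_def indicator_def)
qed (use h in auto)

lemma shift_measurable: "shift \<in> measurable control_borel control_borel"
proof (rule measurable_control_lipschitz[where C="1 / (1 - h)"])
  show "shift u \<in> controls" if "u \<in> controls" for u :: "'a control" by (rule shift_in_controls[OF that])
  show "L1_dist (shift u) (shift v) \<le> 1 / (1 - h) * L1_dist u v"
    if uv: "u \<in> controls" "v \<in> controls" for u v :: "'a control"
  proof -
    have "(1 - h) * L1_dist (shift u) (shift v) =
        (LINT s|L01. indicator {h..1} s * norm (shift u ((s - h) / (1 - h)) - shift v ((s - h) / (1 - h))))"
      unfolding L1_dist_def integral_rescaled[symmetric] ..
    also have "\<dots> = (LINT s|L01. indicator {h..1} s * norm (u s - v s))"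
      using unscale_bounds
      by (intro Bochner_Integration.integral_cong) (auto simp: shift_def indicator_def scale_unscale)
    also have "\<dots> \<le> L1_dist u v"
      unfolding L1_dist_def
    proof (rule Bochner_Integration.integral_mono)
      have "(\<lambda>s. indicator {h..1} s :: real) \<in> borel_measurable L01" by (rule borel_measurable_L01I) auto
      then show "integrable L01 (\<lambda>s. indicator {h..1} s * norm (u s - v s))"
        using integrable_control_diff[OF uv]
        by (rule_tac Bochner_Integration.integrable_bound[OF integrable_control_diff[OF uv]])
           (auto intro!: borel_measurable_times AE_I2 simp: indicator_def)
    qed (use integrable_control_diff[OF uv] in \<open>auto simp: indicator_def\<close>)
    finally show ?thesis using h by (simp add: field_simps)
  qed
qed (use h in auto)

lemma agree_join:
  assumes "agree t v v'"
  shows "agree (h + (1 - h) * t) (join b v) (join b v')"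
proof -
  have "AE s in lebesgue. - h / (1 - h) + (1 / (1 - h)) * s \<in> {0..t} \<longrightarrow>
      v (- h / (1 - h) + (1 / (1 - h)) * s) = v' (- h / (1 - h) + (1 / (1 - h)) * s)"
    using assms h unfolding agree_def by (intro AE_lebesgue_affine[where P="\<lambda>s. s \<in> {0..t} \<longrightarrow> v s = v' s"]) auto
  then show ?thesis
    unfolding agree_def unscale_eq_affine[symmetric]
  proof eventually_elim
    case (elim s)
    show ?case
    proof
      assume s: "s \<in> {0..h + (1 - h) * t}"
      show "join b v s = join b v' s"
      proof (cases "s < h")
        case False
        then have "(s - h) / (1 - h) \<in> {0..t}" using s h by (auto simp: field_simps)
        then show ?thesis using elim by (auto simp: join_def)
      qed (auto simp: join_def)
    qed
  qed
qed

lemma agree_join_before: "t \<le> h \<Longrightarrow> agree t (join b v) (join b v')"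
proof -
  assume t: "t \<le> h"
  have "AE s in lebesgue. s \<noteq> h" by (rule AE_I'[of "{h}"]) auto
  then show ?thesis
    unfolding agree_def by eventually_elim (use t in \<open>auto simp: join_def\<close>)
qed

text \<open>Up to time \<open>h\<close> the continuation \<open>v\<close> is invisible, so a
  deterministic opponent replies as it would to the constant \<open>b\<close>. Hence what player 2
  observes by time \<open>h\<close> depends on the opponent alone. Agreement is almost everywhere,
  since at \<open>h\<close> itself \<open>join\<close> already shows \<open>v\<close>.\<close>

lemma agree_join_const: "agree h (join b v) (\<lambda>s\<in>{0..1}. b)"
proof -
  have "AE s in lebesgue. s \<noteq> h" by (rule AE_I'[of "{h}"]) auto
  then show ?thesis
    unfolding agree_def by eventually_elim (auto simp: join_def)
qed

lemma agree_shift: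
  assumes "agree (h + (1 - h) * t) u u'"
  shows "agree t (shift u) (shift u')"
proof -
  have "AE s in lebesgue. h + (1 - h) * s \<in> {0..h + (1 - h) * t} \<longrightarrow> u (h + (1 - h) * s) = u' (h + (1 - h) * s)"
    using assms h unfolding agree_def
    by (intro AE_lebesgue_affine[where P="\<lambda>s. s \<in> {0..h + (1 - h) * t} \<longrightarrow> u s = u' s"]) auto
  then show ?thesis
    unfolding agree_def
  proof eventually_elim
    case (elim s)
    have "h + (1 - h) * s \<in> {0..h + (1 - h) * t}" if "s \<in> {0..t}"
      using that h by (auto intro: add_nonneg_nonneg)
    then show ?case using elim by (auto simp: shift_def)
  qed
qed

text \<open>By bilinearity the payoff before \<open>h\<close> against a constant action depends on
  \<open>u\<close> only through this vector, so it is all that player 2 has to observe.\<close>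

definition average :: "'n::finite control \<Rightarrow> real ^ 'n" where
  "average u = (\<chi> i. (1 / h) * (LINT s|L01. indicator {..<h} s * u s $ i))"

lemma integral_before: "(LINT s|L01. indicator {..<h} s) = h"
proof -
  have "(LINT s|L01. indicator {..<h} s) = measure L01 ({..<h} \<inter> {0..1})" by simp
  also have "\<dots> = measure lebesgue ({..<h} \<inter> {0..1})" by (rule measure_restrict_space) auto
  also have "{..<h} \<inter> {0..1} = {0..<h}" using h by auto
  finally show ?thesis using h by simp
qed

lemma indicator_before_measurable: "(\<lambda>s. indicator {..<h} s :: real) \<in> borel_measurable L01"
  by (rule borel_measurable_L01I) auto

lemma integrable_control_before: "u \<in> controls \<Longrightarrow> integrable L01 (\<lambda>s. indicator {..<h} s * u s $ i)"
  by (rule integrable_control_weighted[OF _ indicator_before_measurable]) (auto simp: indicator_def)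

lemma average_in_simplex:
  assumes u: "u \<in> controls"
  shows "average u \<in> prob_simplex"
proof -
  have "(\<Sum>i\<in>UNIV. LINT s|L01. indicator {..<h} s * u s $ i) = (LINT s|L01. (\<Sum>i\<in>UNIV. indicator {..<h} s * u s $ i))"
    by (rule Bochner_Integration.integral_sum[symmetric]) (rule integrable_control_before[OF u])
  also have "\<dots> = (LINT s|L01. indicator {..<h} s)"
    using prob_simplexD(2)[OF controls_simplex[OF u]]
    by (intro Bochner_Integration.integral_cong) (auto simp flip: sum_distrib_left)
  also have "\<dots> = h" by (rule integral_before)
  finally have "(\<Sum>i\<in>UNIV. average u $ i) = 1"
    using h by (simp add: average_def flip: sum_divide_distrib)
  moreover have "0 \<le> average u $ i" for i
    using h prob_simplexD(1)[OF controls_simplex[OF u]]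
    by (auto simp: average_def intro!: Bochner_Integration.integral_nonneg divide_nonneg_pos)
  ultimately show ?thesis by (simp add: prob_simplex_def)
qed

lemma average_measurable: "(\<lambda>u. average u $ i) \<in> borel_measurable control_borel"
  unfolding average_def
  by (simp, intro borel_measurable_divide borel_measurable_const indicator_integral_measurable) auto

lemma average_cong:
  assumes "agree h u u'" "u \<in> controls" "u' \<in> controls"
  shows "average u = average u'"
proof -
  have "(LINT s|L01. indicator {..<h} s * u s $ i) = (LINT s|L01. indicator {..<h} s * u' s $ i)" for i
  proof (rule integral_cong_AE)
    show "AE s in L01. indicator {..<h} s * u s $ i = indicator {..<h} s * u' s $ i"
      using assms(1) unfolding agree_def
      by (subst AE_restrict_space_iff) (auto elim!: eventually_mono simp: indicator_def)
  qed (use integrable_control_before assms in \<open>auto intro: borel_measurable_integrable\<close>)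
  then show ?thesis by (simp add: average_def)
qed

text \<open>Before \<open>h\<close> linearity in the first action moves the integral into
  \<open>bilin\<close>; after \<open>h\<close> the change of time produces the factor
  \<open>1 - h\<close>.\<close>

lemma running_payoff_join:
  assumes u: "u \<in> controls" and v: "v \<in> controls" and b: "b \<in> prob_simplex"
  shows "running_payoff M u (join b v) = h * bilin M (average u) b + (1 - h) * running_payoff M (shift u) v"
proof -
  have fst_eq: "(LINT s|L01. indicator {..<h} s * bilin M (u s) b) = h * bilin M (average u) b"
  proof -
    have "(LINT s|L01. indicator {..<h} s * bilin M (u s) b) =
      (LINT s|L01. (\<Sum>i\<in>UNIV. \<Sum>j\<in>UNIV. (M $ i $ j * b $ j) * (indicator {..<h} s * u s $ i)))"
      by (rule Bochner_Integration.integral_cong) (auto simp: bilin_def sum_distrib_left mult_ac)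
    also have "\<dots> = (\<Sum>i\<in>UNIV. \<Sum>j\<in>UNIV. (M $ i $ j * b $ j) * (LINT s|L01. indicator {..<h} s * u s $ i))"
      by (simp only: Bochner_Integration.integral_sum Bochner_Integration.integrable_sum
          integrable_mult_right integrable_control_before[OF u] integral_mult_right_zero)
    also have "\<dots> = h * bilin M (average u) b"
      using h by (simp add: bilin_def average_def sum_distrib_left mult_ac)
    finally show ?thesis .
  qed
  have int: "integrable L01 (\<lambda>s. w s * bilin M (u s) (join b v s))"
    if "w \<in> borel_measurable L01" "\<And>s. \<bar>w s\<bar> \<le> 1" for w
    by (rule Bochner_Integration.integrable_bound[OF integrable_bilin_controls[OF u join_in_controls[OF b v], of M]])
       (use that integrable_bilin_controls[OF u join_in_controls[OF b v], of M] in
        \<open>auto intro!: borel_measurable_times AE_I2 mult_left_le_one_le simp: abs_mult\<close>)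
  have "running_payoff M u (join b v) =
      (LINT s|L01. indicator {..<h} s * bilin M (u s) (join b v s) + indicator {h..} s * bilin M (u s) (join b v s))"
    unfolding running_payoff_def by (rule Bochner_Integration.integral_cong) (auto simp: indicator_def)
  also have "\<dots> = (LINT s|L01. indicator {..<h} s * bilin M (u s) (join b v s)) +
      (LINT s|L01. indicator {h..} s * bilin M (u s) (join b v s))"
    by (intro Bochner_Integration.integral_add int)
       (auto simp: indicator_def intro!: borel_measurable_L01I)
  also have "(LINT s|L01. indicator {..<h} s * bilin M (u s) (join b v s)) = (LINT s|L01. indicator {..<h} s * bilin M (u s) b)"
    using h by (intro Bochner_Integration.integral_cong) (auto simp: indicator_def join_def)
  also have "(LINT s|L01. indicator {h..} s * bilin M (u s) (join b v s)) =
      (LINT s|L01. indicator {h..1} s * bilin M (shift u ((s - h) / (1 - h))) (v ((s - h) / (1 - h))))"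
    using unscale_bounds h
    by (intro Bochner_Integration.integral_cong) (auto simp: indicator_def join_def shift_def scale_unscale)
  also have "\<dots> = (1 - h) * running_payoff M (shift u) v"
    unfolding running_payoff_def by (rule integral_rescaled)
  finally show ?thesis by (simp only: fst_eq)
qed

text \<open>The opponent that player 2 faces after time \<open>h\<close>, once \<open>b\<close> has
  been played, read as a strategy for the game on the whole of [0,1].\<close>

definition continuation :: "real ^ 'j::finite \<Rightarrow> ('j control \<Rightarrow> 'i::finite control) \<Rightarrow> 'j control \<Rightarrow> 'i control" where
  "continuation b a v = shift (a (join b v))"

lemma continuation_pure:
  assumes b: "b \<in> prob_simplex" and a: "a \<in> pure_strategies"
  shows "continuation b a \<in> pure_strategies"
proof -
  obtain S where S: "finite S" "delay S a" and am[measurable]: "a \<in> measurable control_borel control_borel"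
    using a by (auto simp: pure_strategies_def)
  note [measurable] = join_measurable[OF b] shift_measurable
  have "continuation b a \<in> measurable control_borel control_borel"
    unfolding continuation_def[abs_def] by measurable
  \<comment> \<open>Delay points of \<open>a\<close> before \<open>h\<close> are sent to negative
    times; \<open>delay\<close> does not confine its set to [0,1].\<close>
  moreover have "delay ((\<lambda>s. (s - h) / (1 - h)) ` S) (continuation b a)"
    unfolding delay_def continuation_def
  proof (intro ballI allI impI agree_shift)
    fix v1 v2 :: "'a control" and t t' :: real
    assume v: "v1 \<in> controls" "v2 \<in> controls" and t: "0 \<le> t" "t \<le> t'" "t' \<le> 1"
      and S': "(\<lambda>s. (s - h) / (1 - h)) ` S \<inter> {t<..<t'} = {}" and ag: "agree t v1 v2"
    have "(1 - h) * t \<le> (1 - h) * t'" using t h by (intro mult_left_mono) auto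
    moreover have "0 \<le> (1 - h) * t" using t h by auto
    moreover have "h + (1 - h) * t' \<le> 1"
    proof -
      have "h + (1 - h) * t' \<le> h + (1 - h)" using t h by (intro add_left_mono mult_left_le) auto
      then show ?thesis by simp
    qed
    moreover have "S \<inter> {h + (1 - h) * t<..<h + (1 - h) * t'} = {}"
    proof -
      have "(s - h) / (1 - h) \<in> {t<..<t'}" if "s \<in> {h + (1 - h) * t<..<h + (1 - h) * t'}" for s
        using that h by (auto simp: field_simps)
      then show ?thesis using S' by blast
    qed
    ultimately show "agree (h + (1 - h) * t') (a (join b v1)) (a (join b v2))"
      using h by (intro delayD[OF S(2) _ _ agree_join[OF ag]] join_in_controls b v) auto
  qed
  ultimately show ?thesis using S(1) by (auto simp: pure_strategies_def)
qed

text \<open>Here \<open>d\<close> is the concatenated strategy of player 2. Its form is prescribed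
  only for controls that agree up to \<open>h\<close> with the reply of \<open>a\<close> to the
  constant \<open>b\<close>, which leaves it free to select other continuations after other
  histories.\<close>

lemma induces_join:
  assumes b: "b \<in> prob_simplex" and a: "a \<in> pure_strategies" and c: "c \<in> pure_strategies"
    and d: "d \<in> pure_strategies" and uv: "induces (continuation b a) c u v"
    and dc: "\<And>w. w \<in> controls \<Longrightarrow> agree h w (a (\<lambda>s\<in>{0..1}. b)) \<Longrightarrow> d w = join b (c (shift w))"
  shows "induces a d (a (join b v)) (join b v)"
proof -
  have v: "v \<in> controls" "u \<in> controls" and ag: "agree 1 (shift (a (join b v))) u" "agree 1 (c u) v"
    using uv by (auto simp: induces_def continuation_def)
  have jv: "join b v \<in> controls" by (rule join_in_controls[OF b v(1)])
  have aj: "a (join b v) \<in> controls" by (rule pure_in_controls[OF a jv])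
  obtain S where S: "delay S a" using a by (auto simp: pure_strategies_def)
  have "agree h (a (join b v)) (a (\<lambda>s\<in>{0..1}. b))"
    using h by (intro delayD[OF S jv const_in_controls[OF b] agree_join_const]) auto
  then have "d (a (join b v)) = join b (c (shift (a (join b v))))" by (rule dc[OF aj])
  moreover have "agree 1 (c (shift (a (join b v)))) v"
    using pure_agree[OF c shift_in_controls[OF aj] v(2) ag(1)] ag(2) by (rule agree_trans)
  then have "agree 1 (join b (c (shift (a (join b v))))) (join b v)"
    using agree_join[of 1] by fastforce
  ultimately show ?thesis using jv aj by (simp add: induces_def)
qed

end

text \<open>\<open>sel_cong\<close> says that the selection uses only what is visible up to
  \<open>h\<close>. Having finitely many continuations keeps the union of their delay points finite
  and lets all of them live on one cube. Against a deterministic \<open>a\<close> the selected index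
  does not depend on the random outcome.\<close>

lemma concatenated_strategy:
  fixes \<gamma> :: "nat \<Rightarrow> ('j::finite, 'i::finite) strategy" and b :: "real ^ 'j"
  assumes h: "0 < h" "h < 1" and b: "b \<in> prob_simplex"
    and \<gamma>: "\<And>i. i < n \<Longrightarrow> \<gamma> i \<in> random_strategies"
    and sel: "sel \<in> measurable control_borel (count_space UNIV)" "\<And>u. u \<in> controls \<Longrightarrow> sel u < n"
    and sel_cong: "\<And>u u'. u \<in> controls \<Longrightarrow> u' \<in> controls \<Longrightarrow> agree h u u' \<Longrightarrow> sel u = sel u'"
  shows "\<exists>\<beta>\<in>random_strategies. \<forall>M. \<forall>a\<in>pure_strategies.
    expected_payoff M a \<beta> = h * bilin M (average h (a (\<lambda>s\<in>{0..1}. b))) b +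
      (1 - h) * expected_payoff M (continuation h b a) (\<gamma> (sel (a (\<lambda>s\<in>{0..1}. b))))"
proof -
  \<comment> \<open>Large enough for every continuation, and positive even for an empty list. The
    continuations may share coordinates, because only one of them is active in any given
    play.\<close>
  define m where "m = Suc (\<Sum>i<n. fst (\<gamma> i))"
  have mi: "fst (\<gamma> i) \<le> m" if "i < n" for i
    using member_le_sum[of i "{..<n}" "\<lambda>i. fst (\<gamma> i)"] that by (auto simp: m_def)
  define g where "g i \<omega> u = snd (\<gamma> i) (restrict \<omega> {..<fst (\<gamma> i)}, u)" for i \<omega> u
  define f where "f = (\<lambda>(\<omega>, u). join h b (g (sel u) \<omega> (shift h u)))"
  have g_meas: "(\<lambda>(\<omega>, u). g i \<omega> u) \<in> measurable (cube m \<Otimes>\<^sub>M control_borel) control_borel" if "i < n" for i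
    unfolding g_def using strategy_on_larger_cube(1)[of "fst (\<gamma> i)" "snd (\<gamma> i)" m] \<gamma>[OF that] mi[OF that] by simp
  have "\<exists>S. finite S \<and> (\<forall>\<omega>\<in>space (cube m). delay S (g i \<omega>))" if "i < n" for i
    unfolding g_def[abs_def]
    using strategy_on_larger_cube(2)[of "fst (\<gamma> i)" "snd (\<gamma> i)" m] \<gamma>[OF that] mi[OF that] by simp
  then obtain S where S: "\<And>i. i < n \<Longrightarrow> finite (S i)"
    "\<And>i \<omega>. i < n \<Longrightarrow> \<omega> \<in> space (cube m) \<Longrightarrow> delay (S i) (g i \<omega>)"
    by metis
  have g_pure: "g i \<omega> \<in> pure_strategies" if "i < n" "\<omega> \<in> space (cube m)" for i \<omega>
    using measurable_Pair2[OF g_meas[OF that(1)] that(2)] S[OF that(1)] that by (auto simp: pure_strategies_def)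
  note [measurable] = join_measurable[OF h b] shift_measurable[OF h] sel(1)
  have f_meas: "f \<in> measurable (cube m \<Otimes>\<^sub>M control_borel) control_borel"
  proof (rule measurable_cong[THEN iffD1])
    \<comment> \<open>Measurability of a countable case distinction is required at every natural
      index, so indices from \<open>n\<close> on receive a constant default; the values of
      \<open>sel\<close> lie below \<open>n\<close>.\<close>
    define G where "G i x = (if i < n then join h b (g i (fst x) (shift h (snd x))) else (\<lambda>s\<in>{0..1}. b))" for i x
    have "G i \<in> measurable (cube m \<Otimes>\<^sub>M control_borel) control_borel" for i
    proof (cases "i < n")
      case True
      note [measurable] = g_meas[OF True]
      have "(\<lambda>x. (\<lambda>(\<omega>, u). g i \<omega> u) (fst x, shift h (snd x))) \<in> measurable (cube m \<Otimes>\<^sub>M control_borel) control_borel"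
        by measurable
      then have "(\<lambda>x. join h b (g i (fst x) (shift h (snd x)))) \<in> measurable (cube m \<Otimes>\<^sub>M control_borel) control_borel"
        by simp
      then show ?thesis using True by (simp add: G_def[abs_def])
    next
      case False
      then show ?thesis by (simp add: G_def[abs_def] const_in_controls[OF b])
    qed
    then show "(\<lambda>x. G (sel (snd x)) x) \<in> measurable (cube m \<Otimes>\<^sub>M control_borel) control_borel"
      by (intro measurable_compose_countable[where f=G and g="\<lambda>x. sel (snd x)"]
          measurable_compose[OF measurable_snd sel(1)])
    show "G (sel (snd x)) x = f x" if "x \<in> space (cube m \<Otimes>\<^sub>M control_borel)" for x
      using that sel(2) by (auto simp: G_def f_def space_pair_measure)
  qed
  \<comment> \<open>The time \<open>h\<close> becomes a delay point: agreement up to some earlier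
    time does not determine the selected continuation. The other points are the delay points of the
    continuations, transported to [h,1].\<close>
  have f_delay: "delay (insert h (\<Union>i<n. (\<lambda>s. h + (1 - h) * s) ` S i)) (\<lambda>u. f (\<omega>, u))"
    if \<omega>: "\<omega> \<in> space (cube m)" for \<omega>
    unfolding delay_def
  proof (intro ballI allI impI)
    fix u1 u2 :: "'i control" and t t' :: real
    assume u: "u1 \<in> controls" "u2 \<in> controls" and t: "0 \<le> t" "t \<le> t'" "t' \<le> 1"
      and S': "insert h (\<Union>i<n. (\<lambda>s. h + (1 - h) * s) ` S i) \<inter> {t<..<t'} = {}" and ag: "agree t u1 u2"
    show "agree t' (f (\<omega>, u1)) (f (\<omega>, u2))"
    proof (cases "t' \<le> h")
      case True
      then show ?thesis by (simp add: f_def agree_join_before[OF h])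
    next
      case False
      have "h \<notin> {t<..<t'}" using S' by auto
      then have th: "h \<le> t" using False by auto
      define i where "i = sel u1"
      have i: "i < n" "sel u2 = i" using sel(2) u sel_cong[OF u agree_mono[OF ag th]] by (auto simp: i_def)
      define r r' where "r = (t - h) / (1 - h)" and "r' = (t' - h) / (1 - h)"
      have r: "h + (1 - h) * r = t" "h + (1 - h) * r' = t'" using h by (auto simp: r_def r'_def)
      have "S i \<inter> {r<..<r'} = {}"
      proof -
        have "h + (1 - h) * s \<in> {t<..<t'}" if "s \<in> {r<..<r'}" for s
          using that h unfolding r[symmetric] by auto
        then show ?thesis using S' i(1) by blast
      qed
      moreover have "0 \<le> r" "r' \<le> 1" using th t h by (auto simp: r_def r'_def)
      moreover have "r \<le> r'" unfolding r_def r'_def using t h by (intro divide_right_mono) auto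
      moreover have "agree r (shift h u1) (shift h u2)" using ag r by (intro agree_shift[OF h]) simp
      ultimately have "agree r' (g i \<omega> (shift h u1)) (g i \<omega> (shift h u2))"
        by (intro delayD[OF S(2)[OF i(1) \<omega>]] shift_in_controls[OF h] u)
      from agree_join[OF h this, of b] show ?thesis using i by (simp add: f_def r i_def)
    qed
  qed
  have f: "(m, f) \<in> random_strategies"
    unfolding random_strategies_iff
    using f_meas f_delay S(1) by (intro conjI exI[of _ "insert h (\<Union>i<n. (\<lambda>s. h + (1 - h) * s) ` S i)"]) (auto simp: m_def)
  have "expected_payoff M a (m, f) = h * bilin M (average h (a (\<lambda>s\<in>{0..1}. b))) b +
      (1 - h) * expected_payoff M (continuation h b a) (\<gamma> (sel (a (\<lambda>s\<in>{0..1}. b))))"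
    if a: "a \<in> pure_strategies" for M a
  proof -
    \<comment> \<open>The reply to the constant \<open>b\<close> agrees up to \<open>h\<close> with
      the reply in every actual play, so it determines the average and the selected index for all
      random outcomes at once.\<close>
    define u0 where "u0 = a (\<lambda>s\<in>{0..1}. b)"
    have u0: "u0 \<in> controls" unfolding u0_def by (rule pure_in_controls[OF a const_in_controls[OF b]])
    define i where "i = sel u0"
    have i: "i < n" unfolding i_def by (rule sel(2)[OF u0])
    define a' where "a' = continuation h b a"
    have a': "a' \<in> pure_strategies" unfolding a'_def by (rule continuation_pure[OF h b a])
    obtain T where T: "delay T a" using a by (auto simp: pure_strategies_def)
    have payoff: "pure_payoff M a (\<lambda>u. f (\<omega>, u)) = h * bilin M (average h u0) b + (1 - h) * pure_payoff M a' (g i \<omega>)"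
      if \<omega>: "\<omega> \<in> space (cube m)" for \<omega>
    proof -
      obtain u v where uv: "induces a' (g i \<omega>) u v" using induces_exists[OF a' g_pure[OF i \<omega>]] by blast
      have v: "v \<in> controls" "u \<in> controls" using uv by (auto simp: induces_def)
      have jv: "join h b v \<in> controls" by (rule join_in_controls[OF h b v(1)])
      have aj: "a (join h b v) \<in> controls" by (rule pure_in_controls[OF a jv])
      have ind: "induces a (\<lambda>u. f (\<omega>, u)) (a (join h b v)) (join h b v)"
      proof (rule induces_join[OF h b a g_pure[OF i \<omega>] pure_section[OF f \<omega>] uv[unfolded a'_def]])
        fix w :: "'i control" assume "w \<in> controls" "agree h w (a (\<lambda>s\<in>{0..1}. b))"
        then have "sel w = i" using sel_cong u0 unfolding u0_def i_def by blast
        then show "f (\<omega>, w) = join h b (g i \<omega> (shift h w))" by (simp add: f_def)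
      qed
      have ag: "agree h (a (join h b v)) u0"
        unfolding u0_def using h by (intro delayD[OF T jv const_in_controls[OF b] agree_join_const[OF h]]) auto
      have "agree 1 (shift h (a (join h b v))) u" using uv by (simp add: induces_def a'_def continuation_def[OF h])
      then have "running_payoff M (shift h (a (join h b v))) v = running_payoff M u v"
        by (intro running_payoff_cong shift_in_controls[OF h] aj v) simp_all
      then show ?thesis
        using running_payoff_join[OF h aj v(1) b, of M] average_cong[OF h ag aj u0]
        by (simp add: pure_payoff_eq[OF a pure_section[OF f \<omega>] ind] pure_payoff_eq[OF a' g_pure[OF i \<omega>] uv])
    qed
    define P where "P = (\<lambda>\<omega>. pure_payoff M a' (\<lambda>u. snd (\<gamma> i) (\<omega>, u)))"
    have P: "P \<in> borel_measurable (cube (fst (\<gamma> i)))"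
      unfolding P_def using \<gamma>[OF i] by (intro pure_payoff_section_measurable[OF a']) simp
    have Pg: "pure_payoff M a' (g i \<omega>) = P (restrict \<omega> {..<fst (\<gamma> i)})" for \<omega>
      by (simp add: P_def g_def[abs_def])
    interpret prob_space "cube m" by (rule prob_space_cube)
    have intP: "integrable (cube m) (\<lambda>\<omega>. P (restrict \<omega> {..<fst (\<gamma> i)}))"
    proof (rule integrable_const_bound[where B="entry_bound M"])
      show "AE \<omega> in cube m. norm (P (restrict \<omega> {..<fst (\<gamma> i)})) \<le> entry_bound M"
        using pure_payoff_bound[OF a' g_pure[OF i]] by (intro AE_I2) (simp flip: Pg)
      show "(\<lambda>\<omega>. P (restrict \<omega> {..<fst (\<gamma> i)})) \<in> borel_measurable (cube m)"
        by (rule measurable_compose[OF cube_restrict_measurable[OF mi[OF i]] P])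
    qed
    have "expected_payoff M a (m, f) = (LINT \<omega>|cube m. h * bilin M (average h u0) b + (1 - h) * P (restrict \<omega> {..<fst (\<gamma> i)}))"
      unfolding expected_payoff_def by (rule Bochner_Integration.integral_cong) (simp_all add: payoff Pg)
    also have "\<dots> = h * bilin M (average h u0) b + (1 - h) * (LINT \<omega>|cube m. P (restrict \<omega> {..<fst (\<gamma> i)}))"
      using intP prob_space by simp
    also have "(LINT \<omega>|cube m. P (restrict \<omega> {..<fst (\<gamma> i)})) = expected_payoff M a' (\<gamma> i)"
      unfolding cube_restrict_integral[OF mi[OF i] P] by (simp add: P_def expected_payoff_def)
    finally show ?thesis by (simp add: a'_def i_def u0_def)
  qed
  then show ?thesis using f by blast
qed

subsection \<open>The dual game\<close>

definition strategy_profiles :: "('l \<Rightarrow> ('j::finite, 'i::finite) strategy) set" where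
  "strategy_profiles = {\<beta>. \<forall>l. \<beta> l \<in> random_strategies}"

text \<open>Conditional on type \<open>k\<close> of player 1, the type of player 2 has law
  \<open>Q $ k\<close>; the prior \<open>p\<close> on the types of player 1 enters only later, as a
  linear weight.\<close>

definition type_payoff ::
  "('k::finite, 'l::finite, 'i::finite, 'j::finite) games \<Rightarrow> real ^ 'l ^ 'k \<Rightarrow> 'k \<Rightarrow>
     ('j control \<Rightarrow> 'i control) \<Rightarrow> ('l \<Rightarrow> ('j, 'i) strategy) \<Rightarrow> real" where
  "type_payoff G Q k a \<beta> = (\<Sum>l\<in>UNIV. Q $ k $ l * expected_payoff (G k l) a (\<beta> l))"

text \<open>A vector bound, one coordinate per type of player 1, uniform over deterministic replies
  and free of the prior \<open>p\<close>. The dual game asks whether a vector of the form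
  \<open>\<zeta>\<close> plus a constant can be guaranteed.\<close>

definition guarantees where
  "guarantees G Q \<beta> x \<longleftrightarrow> \<beta> \<in> strategy_profiles \<and> (\<forall>k. \<forall>a\<in>pure_strategies. type_payoff G Q k a \<beta> \<le> x $ k)"

definition games_bound :: "('k::finite, 'l::finite, 'i::finite, 'j::finite) games \<Rightarrow> real" where
  "games_bound G = (\<Sum>k\<in>UNIV. \<Sum>l\<in>UNIV. entry_bound (G k l))"

lemma entry_bound_le_games_bound: "(\<Sum>l\<in>UNIV. entry_bound (G k l)) \<le> games_bound G"
  unfolding games_bound_def
  using member_le_sum[of k UNIV "\<lambda>k. \<Sum>l\<in>UNIV. entry_bound (G k l)"] by (auto intro!: sum_nonneg entry_bound_nonneg)

lemma type_payoff_bound: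
  assumes "\<And>k. Q $ k \<in> prob_simplex" "a \<in> pure_strategies" "\<beta> \<in> strategy_profiles"
  shows "\<bar>type_payoff G Q k a \<beta>\<bar> \<le> games_bound G"
proof -
  have "\<bar>type_payoff G Q k a \<beta>\<bar> \<le> (\<Sum>l\<in>UNIV. entry_bound (G k l))"
    unfolding type_payoff_def
  proof (rule order_trans[OF sum_abs], rule sum_mono)
    fix l
    have "\<bar>Q $ k $ l\<bar> * \<bar>expected_payoff (G k l) a (\<beta> l)\<bar> \<le> 1 * entry_bound (G k l)"
      using assms by (intro mult_mono expected_payoff_bound)
        (auto simp: prob_simplex_le1 prob_simplexD strategy_profiles_def)
    then show "\<bar>Q $ k $ l * expected_payoff (G k l) a (\<beta> l)\<bar> \<le> entry_bound (G k l)" by (simp add: abs_mult)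
  qed
  then show ?thesis using entry_bound_le_games_bound order_trans by blast
qed

lemma payoff_tensor:
  assumes \<alpha>: "\<alpha> \<in> strategy_profiles" and \<beta>: "\<beta> \<in> strategy_profiles"
  shows "payoff G (tensor p Q) \<alpha> \<beta> =
      (\<Sum>k\<in>UNIV. p $ k * (LINT \<omega>|cube (fst (\<alpha> k)). type_payoff G Q k (\<lambda>v. snd (\<alpha> k) (\<omega>, v)) \<beta>))"
    and "integrable (cube (fst (\<alpha> k))) (\<lambda>\<omega>. type_payoff G Q k (\<lambda>v. snd (\<alpha> k) (\<omega>, v)) \<beta>)"
proof -
  have rs: "(fst (\<alpha> k), snd (\<alpha> k)) \<in> random_strategies" "(fst (\<beta> l), snd (\<beta> l)) \<in> random_strategies" for k l
    using \<alpha> \<beta> by (auto simp: strategy_profiles_def)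
  have int: "integrable (cube (fst (\<alpha> k))) (\<lambda>\<omega>. expected_payoff M (\<lambda>v. snd (\<alpha> k) (\<omega>, v)) (\<beta> l))" for k l M
    using expected_payoff_Fubini(1)[OF rs] by simp
  show "integrable (cube (fst (\<alpha> k))) (\<lambda>\<omega>. type_payoff G Q k (\<lambda>v. snd (\<alpha> k) (\<omega>, v)) \<beta>)"
    unfolding type_payoff_def by (intro Bochner_Integration.integrable_sum integrable_mult_right int)
  have "(LINT \<omega>|cube (fst (\<alpha> k)). type_payoff G Q k (\<lambda>v. snd (\<alpha> k) (\<omega>, v)) \<beta>) =
      (\<Sum>l\<in>UNIV. Q $ k $ l * (LINT \<omega>|cube (fst (\<alpha> k)). expected_payoff (G k l) (\<lambda>v. snd (\<alpha> k) (\<omega>, v)) (\<beta> l)))" for k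
    unfolding type_payoff_def
    by (subst Bochner_Integration.integral_sum) (auto intro!: integrable_mult_right int)
  then show "payoff G (tensor p Q) \<alpha> \<beta> =
      (\<Sum>k\<in>UNIV. p $ k * (LINT \<omega>|cube (fst (\<alpha> k)). type_payoff G Q k (\<lambda>v. snd (\<alpha> k) (\<omega>, v)) \<beta>))"
    unfolding payoff_conv using expected_payoff_Fubini(2)[OF rs]
    by (simp add: tensor_def sum_distrib_left mult.assoc)
qed

section \<open>Guaranteed vectors, the value and its dual\<close>

lemma payoff_le:
  assumes \<alpha>: "\<alpha> \<in> strategy_profiles" and \<beta>: "guarantees G Q \<beta> x" and p: "p \<in> prob_simplex"
  shows "payoff G (tensor p Q) \<alpha> \<beta> \<le> p \<bullet> x"
proof -
  have \<beta>': "\<beta> \<in> strategy_profiles" using \<beta> by (simp add: guarantees_def)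
  have "(LINT \<omega>|cube (fst (\<alpha> k)). type_payoff G Q k (\<lambda>v. snd (\<alpha> k) (\<omega>, v)) \<beta>) \<le> x $ k" for k
  proof (rule prob_space.integral_le_const[OF prob_space_cube payoff_tensor(2)[OF \<alpha> \<beta>']], rule AE_I2)
    fix \<omega> assume "\<omega> \<in> space (cube (fst (\<alpha> k)))"
    then have "(\<lambda>v. snd (\<alpha> k) (\<omega>, v)) \<in> pure_strategies"
      using \<alpha> by (intro pure_section[of "fst (\<alpha> k)"]) (auto simp: strategy_profiles_def)
    then show "type_payoff G Q k (\<lambda>v. snd (\<alpha> k) (\<omega>, v)) \<beta> \<le> x $ k" using \<beta> by (simp add: guarantees_def)
  qed
  then show ?thesis
    unfolding payoff_tensor(1)[OF \<alpha> \<beta>'] inner_vec_def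
    using p by (auto intro!: sum_mono mult_left_mono simp: prob_simplexD)
qed

lemma payoff_pure:
  assumes a: "\<And>k. a k \<in> pure_strategies" and \<beta>: "\<beta> \<in> strategy_profiles"
  shows "payoff G (tensor p Q) (\<lambda>k. (1, \<lambda>(\<omega>, v). a k v)) \<beta> = (\<Sum>k\<in>UNIV. p $ k * type_payoff G Q k (a k) \<beta>)"
proof -
  have "(\<lambda>k. (1, \<lambda>(\<omega>, v). a k v)) \<in> strategy_profiles"
    using random_of_pure[OF a] by (simp add: strategy_profiles_def)
  from payoff_tensor(1)[OF this \<beta>] show ?thesis
    using prob_space.prob_space[OF prob_space_cube] by simp
qed

lemma pure_strategies_nonempty: "pure_strategies \<noteq> ({} :: ('n::finite control \<Rightarrow> 'm::finite control) set)"
proof -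
  obtain b :: "real^'m" where b: "b \<in> prob_simplex" using prob_simplex_nonempty by blast
  have "(\<lambda>v. \<lambda>s\<in>{0..1}. b) \<in> (pure_strategies :: ('n control \<Rightarrow> 'm control) set)"
    using const_in_controls[OF b] by (auto simp: pure_strategies_def delay_def intro!: exI[of _ "{}"])
  then show ?thesis by blast
qed

lemma strategy_profiles_nonempty: "strategy_profiles \<noteq> ({} :: ('a \<Rightarrow> ('c::finite, 'b::finite) strategy) set)"
proof -
  obtain a :: "'b control \<Rightarrow> 'c control" where "a \<in> pure_strategies" using pure_strategies_nonempty by blast
  from random_of_pure[OF this] show "strategy_profiles \<noteq> ({} :: ('a \<Rightarrow> ('c, 'b) strategy) set)"
    by (auto simp: strategy_profiles_def)
qed

lemma inner_const_vec: "p \<in> prob_simplex \<Longrightarrow> p \<bullet> (\<chi> k. c) = c"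
  by (simp add: inner_vec_def prob_simplexD flip: sum_distrib_right)

context
  fixes G :: "('k::finite, 'l::finite, 'i::finite, 'j::finite) games" and Q :: "real ^ 'l ^ 'k"
  assumes Q: "\<And>k. Q $ k \<in> prob_simplex"
begin

lemma guarantees_games_bound: "\<beta> \<in> strategy_profiles \<Longrightarrow> guarantees G Q \<beta> (\<chi> k. games_bound G)"
  using type_payoff_bound[OF Q] by (auto simp: guarantees_def abs_le_iff)

lemma payoff_bdd_above:
  assumes "p \<in> prob_simplex" "\<beta> \<in> strategy_profiles"
  shows "bdd_above ((\<lambda>\<alpha>. payoff G (tensor p Q) \<alpha> \<beta>) ` strategy_profiles)"
  using payoff_le[OF _ guarantees_games_bound[OF assms(2)] assms(1)] by (intro bdd_aboveI2)

lemma SUP_payoff_ge: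
  assumes p: "p \<in> prob_simplex" and a: "\<And>k. a k \<in> pure_strategies" and \<beta>: "\<beta> \<in> strategy_profiles"
  shows "(\<Sum>k\<in>UNIV. p $ k * type_payoff G Q k (a k) \<beta>) \<le> (SUP \<alpha>\<in>strategy_profiles. payoff G (tensor p Q) \<alpha> \<beta>)"
  unfolding payoff_pure[OF a \<beta>, symmetric]
  using random_of_pure[OF a] by (intro cSUP_upper payoff_bdd_above p \<beta>) (simp add: strategy_profiles_def)

lemma game_value_le:
  assumes \<beta>: "guarantees G Q \<beta> x" and p: "p \<in> prob_simplex"
  shows "game_value G (tensor p Q) \<le> p \<bullet> x"
  unfolding game_value_def strategy_profiles_def[symmetric]
proof (rule cINF_lower2)
  show "\<beta> \<in> strategy_profiles" using \<beta> by (simp add: guarantees_def)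
  show "(SUP \<alpha>\<in>strategy_profiles. payoff G (tensor p Q) \<alpha> \<beta>) \<le> p \<bullet> x"
    using strategy_profiles_nonempty payoff_le[OF _ \<beta> p] by (rule cSUP_least)
  obtain a :: "'j control \<Rightarrow> 'i control" where a: "a \<in> pure_strategies" using pure_strategies_nonempty by blast
  have "- games_bound G \<le> (SUP \<alpha>\<in>strategy_profiles. payoff G (tensor p Q) \<alpha> \<beta>)"
    if \<beta>: "\<beta> \<in> strategy_profiles" for \<beta> :: "'l \<Rightarrow> ('j, 'i) strategy"
  proof -
    have "- games_bound G = (\<Sum>k\<in>UNIV. p $ k * (- games_bound G))"
      using p by (simp add: prob_simplexD sum_negf flip: sum_distrib_right)
    also have "\<dots> \<le> (\<Sum>k\<in>UNIV. p $ k * type_payoff G Q k a \<beta>)"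
      using type_payoff_bound[OF Q a \<beta>, of G] p
      by (intro sum_mono mult_left_mono) (auto simp: prob_simplexD abs_le_iff minus_le_iff)
    also have "\<dots> \<le> (SUP \<alpha>\<in>strategy_profiles. payoff G (tensor p Q) \<alpha> \<beta>)"
      by (rule SUP_payoff_ge[OF p a \<beta>])
    finally show ?thesis .
  qed
  then show "bdd_below ((\<lambda>\<beta>. SUP \<alpha>\<in>strategy_profiles. payoff G (tensor p Q) \<alpha> \<beta>) ` strategy_profiles)"
    by (intro bdd_belowI2)
qed

text \<open>For fixed \<open>\<beta>\<close> the vector \<open>x\<close> of typewise suprema is
  guaranteed, and player 1 comes within \<open>e\<close> of \<open>p \<bullet> x\<close> because
  each type picks its own nearly best reply. Together with \<open>game_value_le\<close> this
  describes the value as the infimum of \<open>p \<bullet> x\<close> over guaranteed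
  \<open>x\<close>.\<close>

lemma game_value_ge:
  assumes p: "p \<in> prob_simplex" and r: "\<And>\<beta> x. guarantees G Q \<beta> x \<Longrightarrow> r \<le> p \<bullet> x"
  shows "r \<le> game_value G (tensor p Q)"
  unfolding game_value_def strategy_profiles_def[symmetric]
proof (rule cINF_greatest[OF strategy_profiles_nonempty])
  fix \<beta> :: "'l \<Rightarrow> ('j, 'i) strategy" assume \<beta>: "\<beta> \<in> strategy_profiles"
  define x where "x = (\<chi> k. SUP a\<in>pure_strategies. type_payoff G Q k a \<beta>)"
  have bdd: "bdd_above ((\<lambda>a. type_payoff G Q k a \<beta>) ` pure_strategies)" for k
    using type_payoff_bound[OF Q _ \<beta>, of _ G] by (intro bdd_aboveI2[where M="games_bound G"]) (simp add: abs_le_iff)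
  have "guarantees G Q \<beta> x"
    using \<beta> by (auto simp: guarantees_def x_def intro!: cSUP_upper bdd)
  then have rx: "r \<le> p \<bullet> x" by (rule r)
  show "r \<le> (SUP \<alpha>\<in>strategy_profiles. payoff G (tensor p Q) \<alpha> \<beta>)"
  proof (rule field_le_epsilon)
    fix e :: real assume e: "e > 0"
    have "\<exists>a\<in>pure_strategies. x $ k - e < type_payoff G Q k a \<beta>" for k
      using less_cSUP_iff[OF pure_strategies_nonempty bdd, of "x $ k - e" k] e by (simp add: x_def)
    then obtain a where a: "\<And>k. a k \<in> pure_strategies" "\<And>k. x $ k - e < type_payoff G Q k (a k) \<beta>" by metis
    have "p \<bullet> x - e = (\<Sum>k\<in>UNIV. p $ k * (x $ k - e))"
      using p by (simp add: inner_vec_def right_diff_distrib sum_subtractf prob_simplexD flip: sum_distrib_right)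
    also have "\<dots> \<le> (\<Sum>k\<in>UNIV. p $ k * type_payoff G Q k (a k) \<beta>)"
      using a(2) p by (intro sum_mono mult_left_mono) (auto simp: prob_simplexD less_imp_le)
    also have "\<dots> \<le> (SUP \<alpha>\<in>strategy_profiles. payoff G (tensor p Q) \<alpha> \<beta>)"
      by (rule SUP_payoff_ge[OF p a(1) \<beta>])
    finally show "r \<le> (SUP \<alpha>\<in>strategy_profiles. payoff G (tensor p Q) \<alpha> \<beta>) + e" using rx by linarith
  qed
qed

lemma W_sharp_upper:
  assumes p: "p \<in> prob_simplex"
  shows "game_value G (tensor p Q) - p \<bullet> \<zeta> \<le> W_sharp G \<zeta> Q"
  unfolding W_sharp_def
proof (rule cSUP_upper[OF p])
  obtain \<beta> :: "'l \<Rightarrow> ('j, 'i) strategy" where \<beta>: "\<beta> \<in> strategy_profiles" using strategy_profiles_nonempty by blast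
  show "bdd_above ((\<lambda>p. game_value G (tensor p Q) - p \<bullet> \<zeta>) ` prob_simplex)"
  proof (rule bdd_aboveI2)
    fix p :: "real^'k" assume p: "p \<in> prob_simplex"
    have "\<bar>p \<bullet> \<zeta>\<bar> \<le> 1 * norm \<zeta>"
      using norm_le_1_prob_simplex[OF p] by (intro order_trans[OF Cauchy_Schwarz_ineq2] mult_right_mono) auto
    then show "game_value G (tensor p Q) - p \<bullet> \<zeta> \<le> games_bound G + norm \<zeta>"
      using game_value_le[OF guarantees_games_bound[OF \<beta>] p] inner_const_vec[OF p, of "games_bound G"] by auto
  qed
qed

lemma W_sharp_le:
  assumes "guarantees G Q \<beta> (\<chi> k. \<zeta> $ k + w)"
  shows "W_sharp G \<zeta> Q \<le> w"
  unfolding W_sharp_def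
proof (rule cSUP_least[OF prob_simplex_nonempty])
  fix p :: "real^'k" assume p: "p \<in> prob_simplex"
  have "p \<bullet> (\<chi> k. \<zeta> $ k + w) = p \<bullet> \<zeta> + p \<bullet> (\<chi> k. w)"
    by (simp add: inner_vec_def distrib_left sum.distrib)
  then show "game_value G (tensor p Q) - p \<bullet> \<zeta> \<le> w"
    using game_value_le[OF assms p] inner_const_vec[OF p] by simp
qed

text \<open>Each type of player 2 tosses a coin of its own with the same weight; separate coins
  suffice because \<open>type_payoff\<close> is a sum over these types.\<close>

lemma convex_guarantees: "convex {x. \<exists>\<beta>. guarantees G Q \<beta> x}"
proof (rule convexI)
  fix x y :: "real^'k" and r s :: real
  assume "x \<in> {x. \<exists>\<beta>. guarantees G Q \<beta> x}" "y \<in> {x. \<exists>\<beta>. guarantees G Q \<beta> x}" and rs: "0 \<le> r" "0 \<le> s" "r + s = 1"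
  then obtain \<beta>1 \<beta>2 where \<beta>: "guarantees G Q \<beta>1 x" "guarantees G Q \<beta>2 y" by blast
  have s: "s = 1 - r" and r1: "r \<le> 1" using rs by auto
  have "\<forall>l. \<exists>\<beta>\<in>random_strategies. \<forall>M. \<forall>a\<in>pure_strategies.
    expected_payoff M a \<beta> = r * expected_payoff M a (\<beta>1 l) + (1 - r) * expected_payoff M a (\<beta>2 l)"
    using \<beta> by (intro allI mixed_strategy rs(1) r1) (auto simp: guarantees_def strategy_profiles_def)
  then obtain \<beta> where b: "\<And>l. \<beta> l \<in> random_strategies" "\<And>l M a. a \<in> pure_strategies \<Longrightarrow>
    expected_payoff M a (\<beta> l) = r * expected_payoff M a (\<beta>1 l) + (1 - r) * expected_payoff M a (\<beta>2 l)"
    by metis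
  have "guarantees G Q \<beta> (r *\<^sub>R x + s *\<^sub>R y)"
    unfolding guarantees_def
  proof (intro conjI allI ballI)
    fix k and a :: "'j control \<Rightarrow> 'i control" assume a: "a \<in> pure_strategies"
    have "type_payoff G Q k a \<beta> = r * type_payoff G Q k a \<beta>1 + s * type_payoff G Q k a \<beta>2"
      unfolding type_payoff_def b(2)[OF a] s
      by (simp add: sum_distrib_left sum.distrib[symmetric] algebra_simps)
    also have "\<dots> \<le> r * x $ k + s * y $ k"
      using \<beta> a rs by (intro add_mono mult_left_mono) (auto simp: guarantees_def)
    finally show "type_payoff G Q k a \<beta> \<le> (r *\<^sub>R x + s *\<^sub>R y) $ k" by simp
  qed (use b in \<open>simp add: strategy_profiles_def\<close>)
  then show "r *\<^sub>R x + s *\<^sub>R y \<in> {x. \<exists>\<beta>. guarantees G Q \<beta> x}" by blast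
qed

text \<open>Anything above a guaranteed vector is guaranteed. If the target is not, every guaranteed
  vector therefore exceeds it in some coordinate, which is the hypothesis of
  \<open>separating_prob_vector\<close>; the resulting prior \<open>p\<close> would force
  \<open>W_sharp\<close> up to at least \<open>w\<close>.\<close>

lemma guarantees_of_W_sharp:
  assumes w: "W_sharp G \<zeta> Q < w"
  shows "\<exists>\<beta>. guarantees G Q \<beta> (\<chi> k. \<zeta> $ k + w)"
proof (rule ccontr)
  assume no: "\<not> ?thesis"
  have "\<exists>k. (\<chi> k. \<zeta> $ k + w) $ k \<le> x $ k" if x: "x \<in> {x. \<exists>\<beta>. guarantees G Q \<beta> x}" for x
  proof (rule ccontr)
    assume "\<not> ?thesis"
    then have le: "x $ k \<le> \<zeta> $ k + w" for k by (simp add: not_le less_imp_le)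
    obtain \<beta> where "guarantees G Q \<beta> x" using x by blast
    then have "guarantees G Q \<beta> (\<chi> k. \<zeta> $ k + w)"
      unfolding guarantees_def using order_trans[OF _ le] by simp
    then show False using no by blast
  qed
  from separating_prob_vector[OF convex_guarantees this] obtain p where p: "p \<in> prob_simplex"
    and sep: "\<And>x \<beta>. guarantees G Q \<beta> x \<Longrightarrow> p \<bullet> (\<chi> k. \<zeta> $ k + w) \<le> p \<bullet> x" by blast
  have "p \<bullet> (\<chi> k. \<zeta> $ k + w) = p \<bullet> \<zeta> + p \<bullet> (\<chi> k. w)"
    by (simp add: inner_vec_def distrib_left sum.distrib)
  moreover have "p \<bullet> (\<chi> k. \<zeta> $ k + w) \<le> game_value G (tensor p Q)"
    using p sep by (rule game_value_ge)
  ultimately show False using W_sharp_upper[OF p, of \<zeta>] w inner_const_vec[OF p, of w] by simp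
qed

end

subsection \<open>The dual subdynamic principle\<close>

text \<open>The displacement from \<open>z\<close> to the updated point is h / (1 - h) times
  \<open>z - g a\<close>, so the factor 1 - h cancels and the first-order term is exactly
  \<open>h * F' (z - g a)\<close>. As \<open>a\<close> depends on \<open>h\<close>, the remainder
  must be small uniformly in the direction; hence the bound \<open>R\<close> and the use of the full
  derivative.\<close>

lemma derivative_of_subdynamic:
  fixes F :: "'a::real_normed_vector \<Rightarrow> real"
  assumes d: "(F has_derivative F') (at z)" and R: "\<And>a. a \<in> U \<Longrightarrow> norm (z - g a) \<le> R"
    and dyn: "\<And>h e. 0 < h \<Longrightarrow> h < 1 \<Longrightarrow> 0 < e \<Longrightarrow>
      \<exists>a\<in>U. F z \<le> (1 - h) * F ((1 / (1 - h)) *\<^sub>R (z - h *\<^sub>R g a)) + h * e"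
    and e: "0 < e"
  shows "\<exists>a\<in>U. F z \<le> F' (z - g a) + e"
proof -
  \<comment> \<open>A positive version of the bound. Half of \<open>e\<close> pays for the remainder
    of the derivative, through the rate \<open>e / (2 * R')\<close>, and half for the error in
    \<open>dyn\<close>.\<close>
  define R' where "R' = max R 1"
  have R': "R' > 0" "\<And>a. a \<in> U \<Longrightarrow> norm (z - g a) \<le> R'" using R by (force simp: R'_def)+
  have "0 < e / (2 * R')" using e R' by simp
  then obtain \<delta> where \<delta>: "\<delta> > 0" and
    D: "\<And>y. norm (y - z) < \<delta> \<Longrightarrow> norm (F y - F z - F' (y - z)) \<le> e / (2 * R') * norm (y - z)"
    using d unfolding has_derivative_at_alt by blast
  \<comment> \<open>With \<open>h\<close> at most 1/2 the displacement is at most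
    \<open>2 * h * R'\<close>, which is at most half of \<open>\<delta>\<close>.\<close>
  define h where "h = min (1/2) (\<delta> / (4 * R'))"
  have h: "0 < h" "h \<le> 1/2" "h < 1" "h * R' \<le> \<delta> / 4"
  proof -
    have "h \<le> \<delta> / (4 * R')" by (simp add: h_def)
    then show "h * R' \<le> \<delta> / 4" using R' by (simp add: field_simps)
  qed (use \<delta> R' in \<open>auto simp: h_def\<close>)
  obtain a where a: "a \<in> U" and
    le: "F z \<le> (1 - h) * F ((1 / (1 - h)) *\<^sub>R (z - h *\<^sub>R g a)) + h * (e/2)"
    using dyn[of h "e/2"] h e by auto
  define y where "y = (1 / (1 - h)) *\<^sub>R (z - h *\<^sub>R g a)"
  have yz: "y - z = (h / (1 - h)) *\<^sub>R (z - g a)"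
  proof -
    have "(1 - h) *\<^sub>R (y - z) = h *\<^sub>R (z - g a)"
      using h by (simp add: y_def scaleR_diff_right) (simp add: algebra_simps)
    then have "(1 / (1 - h)) *\<^sub>R ((1 - h) *\<^sub>R (y - z)) = (1 / (1 - h)) *\<^sub>R h *\<^sub>R (z - g a)" by simp
    then show ?thesis using h by simp
  qed
  have ny: "(1 - h) * norm (y - z) \<le> h * R'" using h R'(2)[OF a] by (simp add: yz)
  moreover have "(1/2) * norm (y - z) \<le> (1 - h) * norm (y - z)" using h by (intro mult_right_mono) auto
  ultimately have "norm (y - z) < \<delta>" using h \<delta> by linarith
  from D[OF this] have "F y \<le> F z + F' (y - z) + e / (2 * R') * norm (y - z)" by auto
  moreover have distr: "(1 - h) * (A + B + c * N) = (1 - h) * A + (1 - h) * B + c * ((1 - h) * N)"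
    for A B c N :: real by (simp add: algebra_simps)
  ultimately have "(1 - h) * F y \<le> (1 - h) * (F z + F' (y - z) + e / (2 * R') * norm (y - z))"
    using h by (intro mult_left_mono) auto
  also have "\<dots> = (1 - h) * F z + (1 - h) * F' (y - z) + e / (2 * R') * ((1 - h) * norm (y - z))"
    by (rule distr)
  also have "(1 - h) * F' (y - z) = h * F' (z - g a)"
    using h by (simp add: yz linear_scale[OF has_derivative_linear[OF d]] del: scaleR_right_diff_distrib)
  also have "(1 - h) * F z + h * F' (z - g a) + e / (2 * R') * ((1 - h) * norm (y - z)) \<le>
    (1 - h) * F z + h * F' (z - g a) + e / (2 * R') * (h * R')"
    using ny e R' by (intro add_left_mono mult_left_mono) auto
  also have "\<dots> = (1 - h) * F z + h * F' (z - g a) + h * (e / 2)" using R' by simp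
  finally have "h * F z \<le> h * (F' (z - g a) + e)" using le by (simp add: y_def algebra_simps)
  then show ?thesis using h a by (intro bexI[of _ a]) auto
qed

section \<open>Discretising the average action of player 1\<close>

lemma compact_prob_simplex: "compact (prob_simplex :: (real ^ 'n::finite) set)"
proof -
  have "prob_simplex = (\<Inter>i. {x::real^'n. 0 \<le> x $ i}) \<inter> {x. (\<Sum>i\<in>UNIV. x $ i) = 1}"
    by (auto simp: prob_simplex_def)
  also have "closed \<dots>"
    by (intro closed_Int closed_INT ballI closed_Collect_le closed_Collect_eq continuous_intros)
  finally have "closed (prob_simplex :: (real^'n) set)" .
  moreover have "bounded (prob_simplex :: (real^'n) set)"
    using norm_le_1_prob_simplex by (auto simp: bounded_iff)
  ultimately show ?thesis by (simp add: compact_eq_bounded_closed)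
qed

text \<open>Rounding the observed average to such a net reduces player 2 to finitely many
  continuations.\<close>

lemma prob_simplex_net:
  assumes e: "0 < e"
  obtains n :: nat and x :: "nat \<Rightarrow> real ^ 'n::finite"
  where "\<And>i. i < n \<Longrightarrow> x i \<in> prob_simplex" "\<And>a. a \<in> prob_simplex \<Longrightarrow> \<exists>i<n. \<forall>j. \<bar>a $ j - x i $ j\<bar> < e"
proof -
  obtain X :: "(real^'n) set" where X: "finite X" "X \<subseteq> prob_simplex" "prob_simplex \<subseteq> (\<Union>x\<in>X. ball x e)"
    using e by (rule_tac compactE_image[OF compact_prob_simplex, of prob_simplex "\<lambda>x. ball x e"]) auto
  obtain x and n :: nat where x: "X = x ` {i. i < n}" using finite_imp_nat_seg_image_inj_on[OF X(1)] by blast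
  show thesis
  proof (rule that[of n x])
    show "\<exists>i<n. \<forall>j. \<bar>a $ j - x i $ j\<bar> < e" if a: "a \<in> prob_simplex" for a
    proof -
      obtain y where y: "y \<in> X" "dist y a < e" using X(3) a by fastforce
      then obtain i where i: "i < n" "dist (x i) a < e" unfolding x by blast
      have "\<bar>a $ j - x i $ j\<bar> < e" for j
        using component_le_norm_cart[of "a - x i" j] i(2) by (simp add: dist_norm norm_minus_commute)
      then show ?thesis using i by blast
    qed
  qed (use X x in auto)
qed

lemma bilin_diff_bound:
  assumes "b \<in> prob_simplex" "\<And>i. \<bar>a $ i - x $ i\<bar> \<le> e"
  shows "\<bar>bilin M a b - bilin M x b\<bar> \<le> e * entry_bound M"
proof -
  have e0: "0 \<le> e" by (rule order_trans[OF abs_ge_zero assms(2)])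
  have "bilin M a b - bilin M x b = (\<Sum>i\<in>UNIV. \<Sum>j\<in>UNIV. (a $ i - x $ i) * M $ i $ j * b $ j)"
    unfolding bilin_def sum_subtractf[symmetric] by (simp add: left_diff_distrib)
  also have "\<bar>\<dots>\<bar> \<le> (\<Sum>i\<in>UNIV. \<Sum>j\<in>UNIV. e * \<bar>M $ i $ j\<bar>)"
  proof (rule order_trans[OF sum_abs], rule sum_mono, rule order_trans[OF sum_abs], rule sum_mono)
    fix i j
    have "\<bar>a $ i - x $ i\<bar> * \<bar>M $ i $ j\<bar> * \<bar>b $ j\<bar> \<le> e * \<bar>M $ i $ j\<bar> * 1"
      using assms by (intro mult_mono) (auto simp: prob_simplex_le1 prob_simplexD e0)
    then show "\<bar>(a $ i - x $ i) * M $ i $ j * b $ j\<bar> \<le> e * \<bar>M $ i $ j\<bar>" by (simp add: abs_mult)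
  qed
  finally show ?thesis by (simp add: entry_bound_def sum_distrib_left)
qed

text \<open>The vector g(a, b) of the overview; by \<open>inner_mean_payoff\<close> its pairing with
  \<open>p\<close> is the payoff of the average game.\<close>

definition mean_payoff ::
  "('k::finite, 'l::finite, 'i::finite, 'j::finite) games \<Rightarrow> real ^ 'l ^ 'k \<Rightarrow> real ^ 'i \<Rightarrow> real ^ 'j \<Rightarrow> real ^ 'k"
  where "mean_payoff G Q a b = (\<chi> k. \<Sum>l\<in>UNIV. Q $ k $ l * bilin (G k l) a b)"

lemma inner_mean_payoff:
  "p \<bullet> mean_payoff G Q a b = (\<Sum>k\<in>UNIV. \<Sum>l\<in>UNIV. tensor p Q $ (k, l) * bilin (G k l) a b)"
  by (simp add: inner_vec_def mean_payoff_def tensor_def sum_distrib_left mult.assoc)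

context
  fixes G :: "('k::finite, 'l::finite, 'i::finite, 'j::finite) games" and Q :: "real ^ 'l ^ 'k"
  assumes Q: "\<And>k. Q $ k \<in> prob_simplex"
begin

lemma mean_payoff_diff_bound:
  assumes b: "b \<in> prob_simplex" and e: "\<And>i. \<bar>a $ i - x $ i\<bar> \<le> e"
  shows "\<bar>mean_payoff G Q a b $ k - mean_payoff G Q x b $ k\<bar> \<le> e * games_bound G"
proof -
  have e0: "0 \<le> e" by (rule order_trans[OF abs_ge_zero e])
  have "mean_payoff G Q a b $ k - mean_payoff G Q x b $ k =
      (\<Sum>l\<in>UNIV. Q $ k $ l * (bilin (G k l) a b - bilin (G k l) x b))"
    by (simp add: mean_payoff_def sum_subtractf right_diff_distrib)
  also have "\<bar>\<dots>\<bar> \<le> (\<Sum>l\<in>UNIV. e * entry_bound (G k l))"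
  proof (rule order_trans[OF sum_abs], rule sum_mono)
    fix l
    have "\<bar>Q $ k $ l\<bar> * \<bar>bilin (G k l) a b - bilin (G k l) x b\<bar> \<le> 1 * (e * entry_bound (G k l))"
      using Q by (intro mult_mono bilin_diff_bound b e) (auto simp: prob_simplex_le1 prob_simplexD)
    then show "\<bar>Q $ k $ l * (bilin (G k l) a b - bilin (G k l) x b)\<bar> \<le> e * entry_bound (G k l)"
      by (simp add: abs_mult)
  qed
  also have "\<dots> \<le> e * games_bound G"
    unfolding sum_distrib_left[symmetric] by (intro mult_left_mono entry_bound_le_games_bound e0)
  finally show ?thesis .
qed

text \<open>
  Player 2 plays \<open>b\<close> up to time \<open>h\<close>, whatever player 1 does, and then
  continues with a strategy that is nearly optimal in the dual game at the parameter reached by then.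
\<close>

lemma W_sharp_subdynamic:
  assumes h: "0 < h" "h < 1" and e: "0 < e" and b: "b \<in> prob_simplex"
  shows "\<exists>a\<in>prob_simplex. W_sharp G \<zeta> Q \<le>
    (1 - h) * W_sharp G ((1 / (1 - h)) *\<^sub>R (\<zeta> - h *\<^sub>R mean_payoff G Q a b)) Q + h * e"
proof -
  have K0: "0 \<le> games_bound G" by (auto simp: games_bound_def intro!: sum_nonneg entry_bound_nonneg)
  \<comment> \<open>Mesh of the net: rounding changes \<open>mean_payoff\<close> by at most e / 2.
    The added 1 keeps the divisor positive when all matrices vanish.\<close>
  define d where "d = e / (2 * (games_bound G + 1))"
  have d: "0 < d" using e K0 by (simp add: d_def)
  have dK: "d * games_bound G \<le> e / 2"
  proof -
    have "d * games_bound G \<le> d * (games_bound G + 1)" using d by (intro mult_left_mono) auto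
    also have "\<dots> = e / 2"
    proof -
      have "games_bound G + 1 \<noteq> 0" using K0 by simp
      then show ?thesis unfolding d_def by (simp add: divide_simps)
    qed
    finally show ?thesis .
  qed
  obtain n and x :: "nat \<Rightarrow> real^'i" where x: "\<And>i. i < n \<Longrightarrow> x i \<in> prob_simplex"
    "\<And>a. a \<in> prob_simplex \<Longrightarrow> \<exists>i<n. \<forall>j. \<bar>a $ j - x i $ j\<bar> < d"
    using prob_simplex_net[OF d] by metis
  \<comment> \<open>The dual parameter after \<open>x i\<close> has been observed. It solves
    \<open>\<zeta> = h *\<^sub>R mean_payoff G Q (x i) b + (1 - h) *\<^sub>R \<xi> i\<close>, so
    that the payoff before \<open>h\<close> cancels in the final bound.\<close>
  define \<xi> where "\<xi> i = (1 / (1 - h)) *\<^sub>R (\<zeta> - h *\<^sub>R mean_payoff G Q (x i) b)" for i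
  \<comment> \<open>The slack that makes the dual inequality strict; multiplied by
    \<open>1 - h\<close> it costs h e / 2, the other half of the budget being spent on
    rounding.\<close>
  define w where "w i = W_sharp G (\<xi> i) Q + h * e / (2 * (1 - h))" for i
  have "\<exists>\<beta>. guarantees G Q \<beta> (\<chi> k. \<xi> i $ k + w i)" for i
    using h e by (intro guarantees_of_W_sharp[OF Q]) (simp add: w_def)
  then obtain \<beta> where \<beta>: "\<And>i. guarantees G Q (\<beta> i) (\<chi> k. \<xi> i $ k + w i)" by metis
  \<comment> \<open>Taking the least admissible index makes the rounding measurable and a function
    of \<open>average h u\<close> alone, hence of the play before \<open>h\<close>.\<close>
  define sel where "sel u = (LEAST i. \<forall>j. \<bar>average h u $ j - x i $ j\<bar> < d)" for u
  have sel: "sel u < n" "\<And>j. \<bar>average h u $ j - x (sel u) $ j\<bar> < d" if u: "u \<in> controls" for u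
  proof -
    obtain i where i: "i < n" "\<forall>j. \<bar>average h u $ j - x i $ j\<bar> < d" using x(2)[OF average_in_simplex[OF h u]] by blast
    show "sel u < n" using Least_le[of "\<lambda>i. \<forall>j. \<bar>average h u $ j - x i $ j\<bar> < d", OF i(2)] i(1) by (simp add: sel_def)
    show "\<bar>average h u $ j - x (sel u) $ j\<bar> < d" for j
      using LeastI[of "\<lambda>i. \<forall>j. \<bar>average h u $ j - x i $ j\<bar> < d", OF i(2)] by (simp add: sel_def)
  qed
  note [measurable] = average_measurable[OF h]
  have sel_meas: "sel \<in> measurable control_borel (count_space UNIV)"
    unfolding sel_def by measurable
  have sel_cong: "sel u = sel u'" if "u \<in> controls" "u' \<in> controls" "agree h u u'" for u u'
    unfolding sel_def average_cong[OF h that(3,1,2)] ..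
  have "\<forall>l. \<exists>\<beta>'\<in>random_strategies. \<forall>M. \<forall>a\<in>pure_strategies.
    expected_payoff M a \<beta>' = h * bilin M (average h (a (\<lambda>s\<in>{0..1}. b))) b +
      (1 - h) * expected_payoff M (continuation h b a) (\<beta> (sel (a (\<lambda>s\<in>{0..1}. b))) l)"
    using \<beta> by (intro allI concatenated_strategy[OF h b, where n=n and \<gamma>="\<lambda>i. \<beta> i _"] sel_meas sel(1) sel_cong)
      (auto simp: guarantees_def strategy_profiles_def)
  then obtain \<beta>' where \<beta>': "\<And>l. \<beta>' l \<in> random_strategies" "\<And>l M a. a \<in> pure_strategies \<Longrightarrow>
    expected_payoff M a (\<beta>' l) = h * bilin M (average h (a (\<lambda>s\<in>{0..1}. b))) b +
      (1 - h) * expected_payoff M (continuation h b a) (\<beta> (sel (a (\<lambda>s\<in>{0..1}. b))) l)" by metis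
  \<comment> \<open>The net point with the largest \<open>V\<close> is the worst case for player 2
    and supplies the action \<open>a\<close> of the statement.\<close>
  define V where "V i = (1 - h) * W_sharp G (\<xi> i) Q" for i
  obtain i where "i < n" using x(2)[OF axis_in_prob_simplex[of undefined]] by blast
  then have "n > 0" by linarith
  then have "Max (V ` {..<n}) \<in> V ` {..<n}" by (intro Max_in) auto
  then obtain i0 where "i0 < n" "Max (V ` {..<n}) = V i0" by blast
  then have i0: "i0 < n" "\<And>i. i < n \<Longrightarrow> V i \<le> V i0" using Max_ge[of "V ` {..<n}"] by auto
  have "guarantees G Q \<beta>' (\<chi> k. \<zeta> $ k + (V i0 + h * e))"
    unfolding guarantees_def
  proof (intro conjI allI ballI)
    fix k and a :: "'j control \<Rightarrow> 'i control" assume a: "a \<in> pure_strategies"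
    define u where "u = a (\<lambda>s\<in>{0..1}. b)"
    have u: "u \<in> controls" unfolding u_def by (rule pure_in_controls[OF a const_in_controls[OF b]])
    define i where "i = sel u"
    have i: "i < n" unfolding i_def by (rule sel(1)[OF u])
    have "type_payoff G Q k a \<beta>' = h * mean_payoff G Q (average h u) b $ k +
        (1 - h) * type_payoff G Q k (continuation h b a) (\<beta> i)"
      unfolding type_payoff_def \<beta>'(2)[OF a] mean_payoff_def
      by (simp add: u_def i_def sum_distrib_left sum.distrib[symmetric] algebra_simps)
    also have "\<dots> \<le> h * (mean_payoff G Q (x i) b $ k + e / 2) + (1 - h) * (\<xi> i $ k + w i)"
    proof (intro add_mono mult_left_mono)
      have "\<bar>average h u $ j - x i $ j\<bar> \<le> d" for j using sel(2)[OF u, of j] by (simp add: i_def less_imp_le)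
      from mean_payoff_diff_bound[OF b this, of k] show "mean_payoff G Q (average h u) b $ k \<le> mean_payoff G Q (x i) b $ k + e / 2"
        using dK by linarith
      show "type_payoff G Q k (continuation h b a) (\<beta> i) \<le> \<xi> i $ k + w i"
        using \<beta>[of i] continuation_pure[OF h b a] by (simp add: guarantees_def)
    qed (use h in auto)
    also have "(1 - h) * (\<xi> i $ k + w i) = (\<zeta> $ k - h * mean_payoff G Q (x i) b $ k) + V i + h * e / 2"
    proof -
      have "2 * (1 - h) \<noteq> 0" using h by simp
      then have "(1 - h) * (h * e / (2 * (1 - h))) = h * e / 2" by (simp add: field_simps)
      then show ?thesis using h by (simp add: \<xi>_def w_def V_def distrib_left)
    qed
    also have "h * (mean_payoff G Q (x i) b $ k + e / 2) +
        ((\<zeta> $ k - h * mean_payoff G Q (x i) b $ k) + V i + h * e / 2) = \<zeta> $ k + (V i + h * e)"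
      by (simp add: algebra_simps)
    also have "\<dots> \<le> \<zeta> $ k + (V i0 + h * e)" using i0(2)[OF i] by simp
    finally show "type_payoff G Q k a \<beta>' \<le> (\<chi> k. \<zeta> $ k + (V i0 + h * e)) $ k" by simp
  qed (use \<beta>'(1) in \<open>simp add: strategy_profiles_def\<close>)
  from W_sharp_le[OF Q this] have "W_sharp G \<zeta> Q \<le> V i0 + h * e" .
  then show ?thesis using x(1)[OF i0(1)] unfolding V_def \<xi>_def by blast
qed

text \<open>The coordinates of every \<open>p\<close> sum to one. Differentiated, this says that the
  coordinates of \<open>- gradient\<close> sum to one.\<close>

lemma W_sharp_shift: "W_sharp G (\<zeta> + (\<chi> k. t)) Q = W_sharp G \<zeta> Q - t"
proof -
  have le: "W_sharp G (\<zeta> + (\<chi> k. t)) Q \<le> W_sharp G \<zeta> Q - t" for \<zeta> t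
    unfolding W_sharp_def[of G "\<zeta> + (\<chi> k. t)"]
  proof (rule cSUP_least[OF prob_simplex_nonempty])
    fix p :: "real^'k" assume p: "p \<in> prob_simplex"
    show "game_value G (tensor p Q) - p \<bullet> (\<zeta> + (\<chi> k. t)) \<le> W_sharp G \<zeta> Q - t"
      using W_sharp_upper[OF Q p, of G \<zeta>] inner_const_vec[OF p, of t] by (simp add: inner_add_right)
  qed
  have "\<zeta> + (\<chi> k. t) + (\<chi> k. - t) = \<zeta>" by (simp add: vec_eq_iff)
  then show ?thesis using le[of \<zeta> t] le[of "\<zeta> + (\<chi> k. t)" "- t"] by (simp only:)
qed

text \<open>The coordinates of every \<open>p\<close> are nonnegative; for the derivative this
  becomes nonnegativity of \<open>- gradient\<close>.\<close>

lemma W_sharp_mono: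
  assumes "0 \<le> t"
  shows "W_sharp G (\<zeta> + t *\<^sub>R axis k 1) Q \<le> W_sharp G \<zeta> Q"
  unfolding W_sharp_def[of G "\<zeta> + t *\<^sub>R axis k 1"]
proof (rule cSUP_least[OF prob_simplex_nonempty])
  fix p :: "real^'k" assume p: "p \<in> prob_simplex"
  have "p \<bullet> (\<zeta> + t *\<^sub>R axis k 1) = p \<bullet> \<zeta> + t * p $ k" by (simp add: inner_add_right inner_axis)
  moreover have "0 \<le> t * p $ k" using assms p by (simp add: prob_simplexD)
  ultimately show "game_value G (tensor p Q) - p \<bullet> (\<zeta> + t *\<^sub>R axis k 1) \<le> W_sharp G \<zeta> Q"
    using W_sharp_upper[OF Q p, of G \<zeta>] by linarith
qed

text \<open>Membership in the simplex is read off the behaviour of \<open>W_sharp\<close> along the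
  diagonal and along the axes, instead of from a maximiser in its definition.\<close>

lemma W_sharp_gradient:
  assumes d: "(\<lambda>\<zeta>. W_sharp G \<zeta> Q) differentiable (at \<zeta>0)"
  defines "p0 \<equiv> - gradient (\<lambda>\<zeta>. W_sharp G \<zeta> Q) \<zeta>0"
  shows "((\<lambda>\<zeta>. W_sharp G \<zeta> Q) has_derivative (\<lambda>y. - (p0 \<bullet> y))) (at \<zeta>0)" and "p0 \<in> prob_simplex"
proof -
  define F where "F = (\<lambda>\<zeta>. W_sharp G \<zeta> Q)"
  define D where "D = frechet_derivative F (at \<zeta>0)"
  have D: "(F has_derivative D) (at \<zeta>0)" using d by (simp add: D_def F_def frechet_derivative_works[symmetric])
  interpret D: linear D by (rule has_derivative_linear[OF D])
  have p0: "p0 $ k = - D (axis k 1)" for k by (simp add: p0_def gradient_def D_def F_def)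
  have Dy: "D y = - (p0 \<bullet> y)" for y
  proof -
    have "D y = D (\<Sum>k\<in>UNIV. y $ k *\<^sub>R axis k 1)"
      using basis_expansion[of y] by (simp add: scalar_mult_eq_scaleR)
    also have "\<dots> = (\<Sum>k\<in>UNIV. y $ k * D (axis k 1))" by (simp add: D.sum D.scaleR)
    finally show ?thesis by (simp add: inner_vec_def p0 sum_negf mult.commute)
  qed
  have DD: "D = (\<lambda>y. - (p0 \<bullet> y))" using Dy by blast
  show "((\<lambda>\<zeta>. W_sharp G \<zeta> Q) has_derivative (\<lambda>y. - (p0 \<bullet> y))) (at \<zeta>0)"
    using D unfolding DD F_def .
  have dir: "((\<lambda>t. F (\<zeta>0 + t *\<^sub>R y)) has_real_derivative D y) (at 0)" for y
  proof -
    have "((\<lambda>t. \<zeta>0 + t *\<^sub>R y) has_derivative (\<lambda>t. t *\<^sub>R y)) (at 0)"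
      by (auto intro!: derivative_eq_intros)
    from has_derivative_compose[OF this, of F D] D
    have "((\<lambda>t. F (\<zeta>0 + t *\<^sub>R y)) has_derivative (\<lambda>t. D (t *\<^sub>R y))) (at 0)" by simp
    moreover have "(\<lambda>t. D (t *\<^sub>R y)) = (*) (D y)" by (auto simp: D.scaleR)
    ultimately show ?thesis by (simp add: has_field_derivative_def)
  qed
  have "D (\<chi> k. 1) = - 1"
  proof (rule DERIV_unique[OF dir])
    have "(\<lambda>t. F (\<zeta>0 + t *\<^sub>R (\<chi> k. 1))) = (\<lambda>t. F \<zeta>0 - t)"
      using W_sharp_shift[of \<zeta>0] by (auto simp: F_def scaleR_vec_def)
    then show "((\<lambda>t. F (\<zeta>0 + t *\<^sub>R (\<chi> k. 1))) has_real_derivative - 1) (at 0)"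
      by (auto intro!: derivative_eq_intros)
  qed
  then have "(\<Sum>k\<in>UNIV. p0 $ k) = 1" by (simp add: Dy inner_vec_def)
  moreover have "0 \<le> p0 $ k" for k
  proof (rule ccontr)
    assume "\<not> ?thesis"
    then have "0 < D (axis k 1)" by (simp add: p0)
    \<comment> \<open>A positive slope along an axis would make \<open>W_sharp\<close> increase
      strictly, against \<open>W_sharp_mono\<close>.\<close>
    from DERIV_pos_inc_right[OF dir this] obtain r where r: "r > 0"
      "\<And>t. 0 < t \<Longrightarrow> t < r \<Longrightarrow> F \<zeta>0 < F (\<zeta>0 + t *\<^sub>R axis k 1)" by auto
    show False using r(2)[of "r/2"] r(1) W_sharp_mono[of "r/2" \<zeta>0 k] by (simp add: F_def)
  qed
  ultimately show "p0 \<in> prob_simplex" by (simp add: prob_simplex_def)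
qed

end

theorem corollary3p7:
  fixes G :: "('k::finite, 'l::finite, 'i::finite, 'j::finite) games"
    and Q0 :: "real ^ 'l ^ 'k"
    and \<zeta>0 :: "real ^ 'k"
  assumes "\<forall>k. Q0 $ k \<in> prob_simplex"
    and "(\<lambda>\<zeta>. W_sharp G \<zeta> Q0) differentiable (at \<zeta>0)"
  shows "let p0 = - gradient (\<lambda>\<zeta>. W_sharp G \<zeta> Q0) \<zeta>0
         in p0 \<in> prob_simplex \<and> game_value G (tensor p0 Q0) \<le> average_value G (tensor p0 Q0)"
proof -
  define p0 where "p0 = - gradient (\<lambda>\<zeta>. W_sharp G \<zeta> Q0) \<zeta>0"
  have Q: "\<And>k. Q0 $ k \<in> prob_simplex" using assms(1) by blast
  note grad = W_sharp_gradient[OF Q assms(2), folded p0_def]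
  \<comment> \<open>The loss \<open>e\<close> is the one left by
    \<open>derivative_of_subdynamic\<close>; \<open>average_value_ge\<close> then removes the
    dependence of \<open>a\<close> on \<open>b\<close>.\<close>
  have approx: "game_value G (tensor p0 Q0) - e \<le> average_value G (tensor p0 Q0)" if e: "0 < e" for e
  proof (rule average_value_ge)
    fix b :: "real^'j" assume b: "b \<in> prob_simplex"
    have bound: "norm (\<zeta>0 - mean_payoff G Q0 a b) \<le> norm \<zeta>0 + real CARD('k) * games_bound G" if a: "a \<in> prob_simplex" for a
    proof -
      \<comment> \<open>Comparing with the zero vector, where \<open>mean_payoff\<close> vanishes,
        turns the Lipschitz estimate into an absolute bound.\<close>
      have "\<bar>a $ i - 0 $ i\<bar> \<le> 1" for i using a by (simp add: prob_simplex_le1 prob_simplexD)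
      from mean_payoff_diff_bound[OF Q b this, of G]
      have "\<bar>mean_payoff G Q0 a b $ k\<bar> \<le> games_bound G" for k
        by (simp add: mean_payoff_def bilin_def)
      then have "norm (mean_payoff G Q0 a b) \<le> (\<Sum>k\<in>(UNIV::'k set). games_bound G)"
        by (intro order_trans[OF norm_le_l1_cart] sum_mono)
      then show ?thesis using norm_triangle_ineq4[of \<zeta>0 "mean_payoff G Q0 a b"] by simp
    qed
    have "\<exists>a\<in>prob_simplex. W_sharp G \<zeta>0 Q0 \<le> - (p0 \<bullet> (\<zeta>0 - mean_payoff G Q0 a b)) + e"
    proof (rule derivative_of_subdynamic[OF grad(1) bound _ e])
      show "\<exists>a\<in>prob_simplex. W_sharp G \<zeta>0 Q0 \<le>
          (1 - h) * W_sharp G ((1 / (1 - h)) *\<^sub>R (\<zeta>0 - h *\<^sub>R mean_payoff G Q0 a b)) Q0 + h * e"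
        if "0 < h" "h < 1" "0 < e" for h e
        by (rule W_sharp_subdynamic[OF Q that b])
    qed
    then obtain a where a: "a \<in> prob_simplex"
      "W_sharp G \<zeta>0 Q0 \<le> - (p0 \<bullet> (\<zeta>0 - mean_payoff G Q0 a b)) + e" by blast
    \<comment> \<open>Testing the supremum in \<open>W_sharp\<close> with \<open>p0\<close> itself
      introduces the term \<open>p0 \<bullet> \<zeta>0\<close>, which cancels the one coming from
      the derivative.\<close>
    have "game_value G (tensor p0 Q0) - e \<le> p0 \<bullet> mean_payoff G Q0 a b"
      using W_sharp_upper[OF Q grad(2), of G \<zeta>0] a(2) by (simp add: inner_diff_right)
    with a(1) have "\<exists>a\<in>prob_simplex. game_value G (tensor p0 Q0) - e \<le> p0 \<bullet> mean_payoff G Q0 a b" ..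
    then show "\<exists>a\<in>prob_simplex. game_value G (tensor p0 Q0) - e \<le>
        (\<Sum>k\<in>UNIV. \<Sum>l\<in>UNIV. tensor p0 Q0 $ (k, l) * bilin (G k l) a b)"
      unfolding inner_mean_payoff .
  qed
  have "game_value G (tensor p0 Q0) \<le> average_value G (tensor p0 Q0)"
  proof (rule field_le_epsilon)
    fix e :: real assume "0 < e"
    from approx[OF this] show "game_value G (tensor p0 Q0) \<le> average_value G (tensor p0 Q0) + e" by linarith
  qed
  then show ?thesis using grad(2) unfolding Let_def p0_def[symmetric] by blast
qed

end
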